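(* Let $\mathbf C$ be a full subcategory of $\mathbf{OMet}_{ners}$ such that for every positive integer $m$ and every $\delta\in\mathrm{Spec}(\mathbf C)$ there is an integer $n\ge m$ such that $\mathcal M_{n,\delta}\in\mathrm{Ob}(\mathbf C)$. Then $\mathbf C$ has the dual Ramsey property. In particular, the following categories have the dual Ramsey property: (1) the category $\mathbf{OMet}_{ners}$; (2) for each $S\subseteq\mathbb R$, the full subcategory $\mathbf{OMet}_{ners}(S)$ of $\mathbf{OMet}_{ners}$ spanned by all finite linearly ordered metric spaces $\mathcal M$ with $\mathrm{Spec}(\mathcal M)\subseteq S$.
   Context: A linearly ordered metric space is $\mathcal M=(M,d,\sqsubset)$ with $d$ a metric on $M$ and $\sqsubset$ a (strict) linear order on $M$. A surjection $f$ between finite chains $(X,\sqsubset)\to(Y,\sqsubset')$ is rigid if $\min f^{-1}(x)\sqsubset\min f^{-1}(y)$ whenever $x\sqsubset'y$. A non-expansive rigid surjection from $(M,d,\sqsubset)$ to $(M',d',\sqsubset')$ is a map $f:M\to M'$ with $d'(f(x),f(y))\le d(x,y)$ for all $x,y\in M$ and such that $f:(M,\sqsubset)\to(M',\sqsubset')$ is a rigid surjection. $\mathbf{OMet}_{ners}$ is the category of finite linearly ordered metric spaces and non-expansive rigid surjections. $\mathrm{Spec}(\mathcal M)=\{d(x,y):x,y\in M,\ x\ne y\}$, and $\mathrm{Spec}(\mathbf C)=\bigcup\{\mathrm{Spec}(\mathcal M):\mathcal M\in\mathrm{Ob}(\mathbf C)\}$. For a positive integer $n$ and a real $\delta>0$,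 $\mathcal M_{n,\delta}=(\{1,\ldots,n\},d_n^\delta,<)$ where $<$ is the usual order and $d_n^\delta(x,y)=\delta$ whenever $x\neq y$. A category $\mathbf C$ has the dual Ramsey property if for every integer $k\ge2$ and all objects $\mathcal A,\mathcal B$ with $\hom_{\mathbf C}(\mathcal B,\mathcal A)\neq\varnothing$ there is an object $\mathcal C$ such that for every coloring $\chi:\hom_{\mathbf C}(\mathcal C,\mathcal A)\to\{1,\ldots,k\}$ there is $w\in\hom_{\mathbf C}(\mathcal C,\mathcal B)$ such that $\chi$ is constant on $\{f\cdot w: f\in\hom_{\mathbf C}(\mathcal B,\mathcal A)\}$. *)

theory Defs
  imports "HOL-Analysis.Analysis"
begin

section \<open>Categories and the dual Ramsey property\<close>

text \<open>
  A morphism of type \<^typ>\<open>'m\<close> need not determine its domain and codomain, so composition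
  is indexed by objects: \<open>Comp C X Y Z g f\<close> is the composite \<open>g \<cdot> f\<close> of
  \<open>f \<in> Hom C X Y\<close> and \<open>g \<in> Hom C Y Z\<close>.
\<close>

record ('o, 'm) cat =
  Ob :: "'o set"
  Hom :: "'o \<Rightarrow> 'o \<Rightarrow> 'm set"
  Comp :: "'o \<Rightarrow> 'o \<Rightarrow> 'o \<Rightarrow> 'm \<Rightarrow> 'm \<Rightarrow> 'm"

definition is_category :: "('o, 'm) cat \<Rightarrow> bool" where
  "is_category C \<longleftrightarrow>
     (\<forall>X\<in>Ob C. \<forall>Y\<in>Ob C. \<forall>Z\<in>Ob C. \<forall>f\<in>Hom C X Y. \<forall>g\<in>Hom C Y Z.
        Comp C X Y Z g f \<in> Hom C X Z) \<and>
     (\<forall>W\<in>Ob C. \<forall>X\<in>Ob C. \<forall>Y\<in>Ob C. \<forall>Z\<in>Ob C.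
        \<forall>f\<in>Hom C W X. \<forall>g\<in>Hom C X Y. \<forall>h\<in>Hom C Y Z.
        Comp C W Y Z h (Comp C W X Y g f) = Comp C W X Z (Comp C X Y Z h g) f) \<and>
     (\<exists>e. \<forall>X\<in>Ob C. e X \<in> Hom C X X \<and>
        (\<forall>Y\<in>Ob C. (\<forall>f\<in>Hom C X Y. Comp C X X Y f (e X) = f) \<and>
                   (\<forall>f\<in>Hom C Y X. Comp C Y X X (e X) f = f)))"

definition full_subcategory :: "('o, 'm) cat \<Rightarrow> ('o, 'm) cat \<Rightarrow> bool" where
  "full_subcategory C D \<longleftrightarrow>
     Ob C \<subseteq> Ob D \<and>
     (\<forall>X\<in>Ob C. \<forall>Y\<in>Ob C. Hom C X Y = Hom D X Y) \<and>
     (\<forall>X\<in>Ob C. \<forall>Y\<in>Ob C. \<forall>Z\<in>Ob C. \<forall>f\<in>Hom C X Y. \<forall>g\<in>Hom C Y Z.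
        Comp C X Y Z g f = Comp D X Y Z g f)"

definition dual_Ramsey_property :: "('o, 'm) cat \<Rightarrow> bool" where
  "dual_Ramsey_property \<C> \<longleftrightarrow>
     (\<forall>k::nat. k \<ge> 2 \<longrightarrow>
       (\<forall>A\<in>Ob \<C>. \<forall>B\<in>Ob \<C>. Hom \<C> B A \<noteq> {} \<longrightarrow>
         (\<exists>C\<in>Ob \<C>. \<forall>c \<in> Hom \<C> C A \<rightarrow> {1..k}.
           \<exists>w\<in>Hom \<C> C B. c constant_on {Comp \<C> C B A f w | f. f \<in> Hom \<C> B A})))"


section \<open>Finite linearly ordered metric spaces\<close>

record 'a ospace =
  points :: "'a set"
  distance :: "'a \<Rightarrow> 'a \<Rightarrow> real"
  ord_rel :: "('a \<times> 'a) set"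

text \<open>
  The distance is required to vanish and the order to be empty off the carrier, so that a
  linearly ordered metric space is represented by exactly one record. The order is strict.
  The empty space is allowed.
\<close>

definition finite_lo_metric_space :: "'a ospace \<Rightarrow> bool" where
  "finite_lo_metric_space M \<longleftrightarrow>
     finite (points M) \<and>
     Metric_space (points M) (distance M) \<and>
     (\<forall>x y. x \<notin> points M \<or> y \<notin> points M \<longrightarrow> distance M x y = 0) \<and>
     ord_rel M \<subseteq> points M \<times> points M \<and>
     strict_linear_order_on (points M) (ord_rel M)"

definition chain_min :: "('a \<times> 'a) set \<Rightarrow> 'a set \<Rightarrow> 'a" where
  "chain_min r X = (THE m. m \<in> X \<and> (\<forall>x\<in>X. x \<noteq> m \<longrightarrow> (m, x) \<in> r))"

definition rigid_surjection ::
  "'a set \<Rightarrow> ('a \<times> 'a) set \<Rightarrow> 'b set \<Rightarrow> ('b \<times> 'b) set \<Rightarrow> ('a \<Rightarrow> 'b) \<Rightarrow> bool" where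
  "rigid_surjection X r Y s f \<longleftrightarrow>
     f ` X = Y \<and>
     (\<forall>x\<in>Y. \<forall>y\<in>Y. (x, y) \<in> s \<longrightarrow>
        (chain_min r (f -` {x} \<inter> X), chain_min r (f -` {y} \<inter> X)) \<in> r)"

text \<open>Morphisms are extensional, so that equal maps on the carrier are equal morphisms.\<close>

definition ners :: "'a ospace \<Rightarrow> 'a ospace \<Rightarrow> ('a \<Rightarrow> 'a) set" where
  "ners M N = {f \<in> points M \<rightarrow>\<^sub>E points N.
     (\<forall>x\<in>points M. \<forall>y\<in>points M. distance N (f x) (f y) \<le> distance M x y) \<and>
     rigid_surjection (points M) (ord_rel M) (points N) (ord_rel N) f}"

definition OMet_ners :: "('a ospace, 'a \<Rightarrow> 'a) cat" where
  "OMet_ners = \<lparr>Ob = {M. finite_lo_metric_space M}, Hom = ners,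
     Comp = (\<lambda>L M N g f. compose (points L) g f)\<rparr>"

definition Spec :: "'a ospace \<Rightarrow> real set" where
  "Spec M = {distance M x y | x y. x \<in> points M \<and> y \<in> points M \<and> x \<noteq> y}"

definition cat_Spec :: "('a ospace, 'm) cat \<Rightarrow> real set" where
  "cat_Spec C = (\<Union>M\<in>Ob C. Spec M)"

definition OMet_ners_on :: "real set \<Rightarrow> ('a ospace, 'a \<Rightarrow> 'a) cat" where
  "OMet_ners_on S = OMet_ners\<lparr>Ob := {M \<in> Ob OMet_ners. Spec M \<subseteq> S}\<rparr>"

text \<open>
  The space with points \<open>1, \<dots>, n\<close> in their usual order, any two distinct ones at distance
  \<open>\<delta>\<close>. The points of all spaces are taken from an arbitrary type \<^typ>\<open>'a\<close>; the injection
  \<open>\<iota>\<close> says which elements of it are the positive integers.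
\<close>

definition equidistant :: "(nat \<Rightarrow> 'a) \<Rightarrow> nat \<Rightarrow> real \<Rightarrow> 'a ospace" where
  "equidistant \<iota> n \<delta> =
     \<lparr>points = \<iota> ` {1..n},
      distance = (\<lambda>x y. if x \<in> \<iota> ` {1..n} \<and> y \<in> \<iota> ` {1..n} \<and> x \<noteq> y then \<delta> else 0),
      ord_rel = {(\<iota> i, \<iota> j) | i j. 1 \<le> i \<and> i < j \<and> j \<le> n}\<rparr>"


section \<open>Well-formedness of the definitions\<close>

lemma finite_lo_metric_space_equidistant:
  assumes "inj \<iota>" "\<delta> > 0"
  shows "finite_lo_metric_space (equidistant \<iota> n \<delta>)"
proof -
  have "Metric_space (points (equidistant \<iota> n \<delta>)) (distance (equidistant \<iota> n \<delta>))"
    using assms by unfold_locales (auto simp: equidistant_def)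
  moreover have "strict_linear_order_on (points (equidistant \<iota> n \<delta>)) (ord_rel (equidistant \<iota> n \<delta>))"
    unfolding strict_linear_order_on_def
  proof (intro conjI)
    show "trans (ord_rel (equidistant \<iota> n \<delta>))"
      using assms(1) unfolding equidistant_def trans_def ospace.simps inj_def
      by clarsimp (metis less_trans)
    show "irrefl (ord_rel (equidistant \<iota> n \<delta>))"
      using assms(1) by (auto simp: equidistant_def irrefl_def dest!: injD)
    show "total_on (points (equidistant \<iota> n \<delta>)) (ord_rel (equidistant \<iota> n \<delta>))"
      unfolding total_on_def equidistant_def by auto (metis One_nat_def nat_neq_iff)
  qed
  ultimately show ?thesis
    by (auto simp: finite_lo_metric_space_def equidistant_def)
qed

lemma chain_min_eqI:
  assumes "strict_linear_order_on A r" "m \<in> X" "\<And>x. x \<in> X \<Longrightarrow> x \<noteq> m \<Longrightarrow> (m, x) \<in> r"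
  shows "chain_min r X = m"
  unfolding chain_min_def
proof (rule the_equality)
  fix m' assume m': "m' \<in> X \<and> (\<forall>x\<in>X. x \<noteq> m' \<longrightarrow> (m', x) \<in> r)"
  show "m' = m"
  proof (rule ccontr)
    assume "m' \<noteq> m"
    then have "(m, m') \<in> r" "(m', m) \<in> r" using m' assms by auto
    then show False
      using assms(1) unfolding strict_linear_order_on_def trans_def irrefl_def by blast
  qed
qed (use assms in auto)

lemma ex_chain_min:
  assumes "strict_linear_order_on A r" "X \<subseteq> A" "finite X" "X \<noteq> {}"
  shows "\<exists>m\<in>X. \<forall>x\<in>X. x \<noteq> m \<longrightarrow> (m, x) \<in> r"
  using assms(3,4,2)
proof (induction X rule: finite_ne_induct)
  case (insert a X)
  then obtain m where m: "m \<in> X" "\<forall>x\<in>X. x \<noteq> m \<longrightarrow> (m, x) \<in> r" by auto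
  have "a \<noteq> m" using m insert by auto
  then consider "(a, m) \<in> r" | "(m, a) \<in> r"
    using assms(1) insert m(1) by (auto simp: strict_linear_order_on_def total_on_def)
  then show ?case
  proof cases
    case 1
    then have "\<forall>x\<in>X. (a, x) \<in> r"
      using m assms(1) unfolding strict_linear_order_on_def trans_def by metis
    then show ?thesis by auto
  qed (use m in auto)
qed auto

lemma chain_min:
  assumes "strict_linear_order_on A r" "X \<subseteq> A" "finite X" "X \<noteq> {}"
  shows "chain_min r X \<in> X" "\<And>x. x \<in> X \<Longrightarrow> x \<noteq> chain_min r X \<Longrightarrow> (chain_min r X, x) \<in> r"
proof -
  obtain m where m: "m \<in> X" "\<forall>x\<in>X. x \<noteq> m \<longrightarrow> (m, x) \<in> r"
    using ex_chain_min[OF assms] by blast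
  then have "chain_min r X = m"
    by (intro chain_min_eqI[OF assms(1)]) auto
  then show "chain_min r X \<in> X" "\<And>x. x \<in> X \<Longrightarrow> x \<noteq> chain_min r X \<Longrightarrow> (chain_min r X, x) \<in> r"
    using m by auto
qed

lemma rigid_surjection_compose:
  assumes X: "strict_linear_order_on X r" "finite X"
    and Y: "strict_linear_order_on Y s" "finite Y"
    and Z: "strict_linear_order_on Z t"
    and f: "rigid_surjection X r Y s f" and g: "rigid_surjection Y s Z t g"
  shows "rigid_surjection X r Z t (compose X g f)"
proof -
  have fX: "f ` X = Y" and gY: "g ` Y = Z" using f g by (auto simp: rigid_surjection_def)
  have key: "chain_min r (compose X g f -` {z} \<inter> X) =
      chain_min r (f -` {chain_min s (g -` {z} \<inter> Y)} \<inter> X)" if z: "z \<in> Z" for z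
  proof -
    define y where "y = chain_min s (g -` {z} \<inter> Y)"
    have ne: "g -` {z} \<inter> Y \<noteq> {}" using gY z by auto
    have y: "y \<in> g -` {z} \<inter> Y" "\<And>y'. y' \<in> g -` {z} \<inter> Y \<Longrightarrow> y' \<noteq> y \<Longrightarrow> (y, y') \<in> s"
      using chain_min[OF Y(1) _ _ ne] Y(2) unfolding y_def by auto
    have fib: "chain_min r (f -` {v} \<inter> X) \<in> f -` {v} \<inter> X \<and>
      (\<forall>x\<in>f -` {v} \<inter> X. x \<noteq> chain_min r (f -` {v} \<inter> X) \<longrightarrow> (chain_min r (f -` {v} \<inter> X), x) \<in> r)"
      if "v \<in> Y" for v
      using chain_min[OF X(1), of "f -` {v} \<inter> X"] X(2) fX that by auto
    define m where "m = chain_min r (f -` {y} \<inter> X)"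
    have m: "m \<in> X" "f m = y" using fib[of y] y(1) unfolding m_def by auto
    have "(m, x) \<in> r" if x: "x \<in> X" "g (f x) = z" "x \<noteq> m" for x
    proof (cases "f x = y")
      case True
      then show ?thesis using fib[of y] y(1) x unfolding m_def by auto
    next
      case False
      have fx: "f x \<in> Y" using x fX by auto
      then have "(y, f x) \<in> s" using y(2) x False by auto
      then have "(m, chain_min r (f -` {f x} \<inter> X)) \<in> r"
        using f fx y(1) unfolding rigid_surjection_def m_def by auto
      then show ?thesis
        using fib[OF fx] x(1) X(1) unfolding strict_linear_order_on_def trans_def
        by (cases "x = chain_min r (f -` {f x} \<inter> X)") auto
    qed
    then have "chain_min r (compose X g f -` {z} \<inter> X) = m"
      using m y(1) by (intro chain_min_eqI[OF X(1)]) (auto simp: compose_def)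
    then show ?thesis unfolding m_def y_def .
  qed
  have "(chain_min r (compose X g f -` {u} \<inter> X), chain_min r (compose X g f -` {v} \<inter> X)) \<in> r"
    if uv: "u \<in> Z" "v \<in> Z" "(u, v) \<in> t" for u v
  proof -
    have "chain_min s (g -` {u} \<inter> Y) \<in> Y" "chain_min s (g -` {v} \<inter> Y) \<in> Y"
      using chain_min(1)[OF Y(1), of "g -` {u} \<inter> Y"] chain_min(1)[OF Y(1), of "g -` {v} \<inter> Y"]
        Y(2) gY uv by auto
    then show ?thesis
      using f g uv unfolding key[OF uv(1)] key[OF uv(2)] by (auto simp: rigid_surjection_def)
  qed
  moreover have "compose X g f ` X = Z"
    using fX gY by (force simp: compose_def)
  ultimately show ?thesis by (auto simp: rigid_surjection_def)
qed

lemma is_category_OMet_ners: "is_category OMet_ners"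
proof -
  have comp: "compose (points X) g f \<in> ners X Z"
    if "finite_lo_metric_space X" "finite_lo_metric_space Y" "finite_lo_metric_space Z"
      "f \<in> ners X Y" "g \<in> ners Y Z" for X Y Z :: "'a ospace" and f g
  proof -
    have "rigid_surjection (points X) (ord_rel X) (points Z) (ord_rel Z) (compose (points X) g f)"
      by (rule rigid_surjection_compose[of _ _ "points Y" "ord_rel Y"])
        (use that in \<open>auto simp: finite_lo_metric_space_def ners_def\<close>)
    moreover have "distance Z (g (f x)) (g (f y)) \<le> distance X x y"
      if "x \<in> points X" "y \<in> points X" for x y
    proof -
      have "f x \<in> points Y" "f y \<in> points Y"
        using \<open>f \<in> ners X Y\<close> that by (auto simp: ners_def)
      then have "distance Z (g (f x)) (g (f y)) \<le> distance Y (f x) (f y)"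
        using \<open>g \<in> ners Y Z\<close> by (auto simp: ners_def)
      also have "\<dots> \<le> distance X x y"
        using \<open>f \<in> ners X Y\<close> that by (auto simp: ners_def)
      finally show ?thesis .
    qed
    ultimately show ?thesis
      using that by (auto simp: ners_def compose_def PiE_iff)
  qed
  have id: "restrict id (points X) \<in> ners X X" if X: "finite_lo_metric_space X" for X :: "'a ospace"
  proof -
    have "chain_min (ord_rel X) (restrict id (points X) -` {x} \<inter> points X) = x" if "x \<in> points X" for x
      using that X
      by (intro chain_min_eqI[where A = "points X"]) (auto simp: finite_lo_metric_space_def)
    then show ?thesis by (auto simp: ners_def rigid_surjection_def)
  qed
  show ?thesis
    unfolding is_category_def OMet_ners_def cat.simps
    apply (intro conjI ballI exI[where x = "\<lambda>X. restrict id (points X)"])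
        apply (use comp in \<open>auto intro: comp\<close>)[1]
       apply (auto simp: ners_def compose_def restrict_def PiE_iff fun_eq_iff)[1]
      apply (use id in auto)[1]
     apply (auto simp: ners_def compose_def restrict_def PiE_iff extensional_def fun_eq_iff)[1]
    apply (auto simp: ners_def compose_def restrict_def PiE_iff extensional_def fun_eq_iff)[1]
    done
qed

lemma full_subcategory_OMet_ners_on: "full_subcategory (OMet_ners_on S) OMet_ners"
  by (auto simp: full_subcategory_def OMet_ners_on_def)

end

theory Submission
  imports Defs
begin

text \<open>
  If \<open>\<delta>\<close> is the largest distance in \<open>B\<close>, every map from an equidistant space \<open>M\<^sub>n\<^sub>,\<^sub>\<delta>\<close> to \<open>B\<close> or
  to a non-expansive image \<open>A\<close> of \<open>B\<close> is non-expansive, so the claim reduces to the dual Ramsey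
  theorem for rigid surjections between finite chains; if \<open>B\<close> has at most one point, \<open>B\<close> itself
  serves as \<open>C\<close>.

  A rigid surjection is a parameter word without constants, or equivalently (its first letter being
  forced) with a single constant, so the dual Ramsey theorem is a case of the Graham-Rothschild
  theorem for parameter words. That is proved by induction on the number of parameters, turning the
  first parameter into a further constant; the case of no parameters is the Hales-Jewett theorem,
  for which Shelah's argument is used.
\<close>

section \<open>Parameter words\<close>

text \<open>The obstacle in lowering the number of constants is that the first parameter of a word
  may stand anywhere. What follows it is a word with \<open>Suc a\<close> constants, under the
  control of \<open>GR (Suc a) k\<close>. What precedes it is a constant word of variable length:
  inside a subspace \<open>g\<close> it appears as \<open>g\<close> cut before one of its parameters
  and then filled with constants, so Hales-Jewett does not apply to all these prefixes at once. Two
  refinements deal with this. One makes the color depend on the prefix only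
  (\<open>prefix_colors\<close>). The other makes the color of the prefix constant
  (\<open>cut_color\<close>), by Hales-Jewett for one length at a time and a pigeonhole over the
  lengths.

  Keeping the forced first letter as a constant has a practical use: with \<open>a > 0\<close> the
  letter 0 is available to freeze coordinates and to pad words. Colorings are total on lists and
  only required to be bounded, so that induced colorings need no domain conditions.\<close>

text \<open>
  \<open>pword a k t\<close>: the letters below \<open>a\<close> are constants (or parameters already seen), and the
  parameters \<open>a, \<dots>, k - 1\<close> all occur in \<open>t\<close>, in this order of first occurrence.
  \<open>wsubst a h g\<close> replaces the parameter \<open>a + i\<close> of \<open>g\<close> by the \<open>i\<close>-th letter of \<open>h\<close>; read as
  functions on positions with the constants prepended, words compose.
\<close>

fun pword :: "nat \<Rightarrow> nat \<Rightarrow> nat list \<Rightarrow> bool" where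
  "pword a k [] \<longleftrightarrow> k = a"
| "pword a k (x # t) \<longleftrightarrow> x < a \<and> pword a k t \<or> x = a \<and> pword (Suc a) k t"

definition wsubst :: "nat \<Rightarrow> nat list \<Rightarrow> nat list \<Rightarrow> nat list" where
  "wsubst a h g = map ((!) ([0..<a] @ h)) g"

lemma length_wsubst [simp]: "length (wsubst a h g) = length g"
  by (simp add: wsubst_def)

lemma pword_append: "pword a k (s @ t) \<longleftrightarrow> (\<exists>b. pword a b s \<and> pword b k t)"
  by (induction s arbitrary: a) auto

lemma pword_bounds:
  assumes "pword a k t"
  shows "a \<le> k" "set t \<subseteq> {..<k}"
proof -
  have "a \<le> k \<and> set t \<subseteq> {..<k}"
    using assms by (induction a k t rule: pword.induct) auto
  then show "a \<le> k" "set t \<subseteq> {..<k}" by auto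
qed

lemma pword_surj:
  assumes "pword a k t"
  shows "{..<a} \<union> set t = {..<k}"
  using assms
proof (induction a k t rule: pword.induct)
  case (2 a k x t)
  then show ?case by (cases "x < a") (auto simp: lessThan_Suc)
qed auto

lemma pword_const: "pword a a t \<longleftrightarrow> set t \<subseteq> {..<a}"
proof (induction t)
  case (Cons x t)
  have "\<not> pword (Suc a) a t" using pword_bounds(1)[of "Suc a" a t] by auto
  with Cons show ?case by auto
qed auto

lemma pword_upt: "pword a (a + n) [a..<a + n]"
proof (induction n arbitrary: a)
  case (Suc n)
  have "[a..<a + Suc n] = a # [Suc a..<Suc a + n]" by (simp add: upt_conv_Cons del: upt_Suc)
  with Suc[of "Suc a"] show ?case by simp
qed auto

lemma pword_const_append:
  "set u \<subseteq> {..<a} \<Longrightarrow> pword a k (u @ t) \<longleftrightarrow> pword a k t"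
  by (induction u) auto

lemma pword_split:
  assumes "pword a k h" "a < k"
  obtains u t where "h = u @ a # t" "set u \<subseteq> {..<a}" "pword (Suc a) k t"
proof -
  have "\<exists>u t. h = u @ a # t \<and> set u \<subseteq> {..<a} \<and> pword (Suc a) k t" using assms
  proof (induction h)
    case (Cons x h)
    show ?case
    proof (cases "x = a")
      case True
      then show ?thesis using Cons by (intro exI[of _ "[]"] exI[of _ h]) auto
    next
      case False
      then have "x < a" "pword a k h" using Cons.prems by auto
      then obtain u t where "h = u @ a # t" "set u \<subseteq> {..<a}" "pword (Suc a) k t"
        using Cons by blast
      with \<open>x < a\<close> show ?thesis by (intro exI[of _ "x # u"] exI[of _ t]) auto
    qed
  qed auto
  with that show thesis by blast
qed

text \<open>The form of \<open>pword_wsubst\<close> that survives the induction on \<open>g\<close>.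
  A parameter of \<open>g\<close>, once met, counts as a constant from then on, so its image moves
  from the front of \<open>h\<close> to the end of \<open>p\<close>. The bound \<open>a\<close>
  rises with it exactly when that image is itself a new parameter.\<close>

lemma pword_map_nth:
  assumes "pword b m g" "length p = b" "set p \<subseteq> {..<a}" "b + length h = m" "pword a k h"
  shows "pword a k (map ((!) (p @ h)) g)"
  using assms
proof (induction b m g arbitrary: p a h rule: pword.induct)
  case (2 b m x t)
  show ?case
  proof (cases "x < b")
    case True
    then have "p ! x < a" using 2 by (auto dest!: nth_mem)
    then show ?thesis using 2 True by (auto simp: nth_append)
  next
    case False
    then have x: "x = b" "pword (Suc b) m t" using 2 by auto
    from pword_bounds(1)[OF x(2)] 2 obtain y h' where h: "h = y # h'"
      by (cases h) auto
    have nth: "(p @ h) ! x = y" using x h 2 by (simp add: nth_append)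
    have "pword a' k (map ((!) ((p @ [y]) @ h')) t)"
      if "set (p @ [y]) \<subseteq> {..<a'}" "pword a' k h'" for a'
      by (rule "2.IH"(2)[OF x(2)]) (use 2 that h in auto)
    from this[of a] this[of "Suc a"] show ?thesis
      using 2(5,7) nth unfolding h by (fastforce simp: less_Suc_eq)
  qed
qed auto

lemma pword_wsubst:
  assumes "pword a (a + length h) g" "pword a k h"
  shows "pword a k (wsubst a h g)"
  unfolding wsubst_def by (rule pword_map_nth[OF assms(1)]) (use assms in auto)

lemma wsubst_append: "wsubst a h (g1 @ g2) = wsubst a h g1 @ wsubst a h g2"
  by (simp add: wsubst_def)

lemma wsubst_const: "set g \<subseteq> {..<a} \<Longrightarrow> wsubst a h g = g"
  by (auto simp: wsubst_def nth_append intro!: map_idI)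

text \<open>Associativity of composition: a subspace of a subspace is a subspace, which is how
  successive refinements are merged into a single word.\<close>

lemma wsubst_wsubst:
  assumes "set f \<subseteq> {..<a + length g}"
  shows "wsubst a h (wsubst a g f) = wsubst a (wsubst a h g) f"
proof -
  have "([0..<a] @ h) ! (([0..<a] @ g) ! x) = ([0..<a] @ wsubst a h g) ! x"
    if "x < a + length g" for x
    using that by (cases "x < a") (auto simp: nth_append wsubst_def)
  then show ?thesis using assms by (auto simp: wsubst_def)
qed

lemma wsubst_extend:
  assumes "set g \<subseteq> {..<a + length h}"
  shows "wsubst a (h @ h') g = wsubst a h g"
  using assms by (auto simp: wsubst_def nth_append)

lemma set_wsubst:
  assumes "set g \<subseteq> {..<a + length h}" "set h \<subseteq> {..<k}" "a \<le> k"
  shows "set (wsubst a h g) \<subseteq> {..<k}"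
proof -
  have "([0..<a] @ h) ! x < k" if "x < a + length h" for x
  proof (cases "x < a")
    case False
    then have "h ! (x - a) \<in> set h" using that by simp
    then show ?thesis using assms(2) False by (auto simp: nth_append)
  qed (use assms(3) in \<open>simp add: nth_append\<close>)
  then show ?thesis using assms(1) by (auto simp: wsubst_def)
qed

text \<open>Parameters first occur in increasing order, so the first letter of \<open>w\<close> that
  is not below \<open>b\<close> is \<open>b\<close> itself. Only the behavior of \<open>P\<close> up
  to \<open>b\<close> can matter.\<close>

lemma takeWhile_pword:
  assumes "pword a k w" "a \<le> b" "\<And>y. y < b \<Longrightarrow> P y" "\<not> P b"
  shows "takeWhile P w = takeWhile (\<lambda>y. y < b) w"
  using assms
proof (induction a k w rule: pword.induct)
  case (2 a k x t)
  then show ?case by (cases "x < a"; cases "a = b") auto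
qed auto

text \<open>The first letter of \<open>g\<close> that is not below \<open>a + i\<close> stands at
  position \<open>q\<close>, and position \<open>q\<close> of \<open>g\<close> is what the parameter
  \<open>a + q\<close> of \<open>w\<close> is replaced by. Cutting the composite at level
  \<open>i\<close> therefore amounts to cutting \<open>w\<close> at level \<open>q\<close>.\<close>

lemma cut_wsubst:
  assumes w: "pword a k w" and u: "length u = i"
    and q: "q = length (takeWhile (\<lambda>x. x < a + i) g)" "q < length g"
  shows "wsubst a u (takeWhile (\<lambda>x. x < a + i) (wsubst a g w)) =
    wsubst a (wsubst a u (takeWhile (\<lambda>x. x < a + i) g)) (takeWhile (\<lambda>x. x < a + q) w)"
proof -
  let ?G = "[0..<a] @ g"
  have t: "takeWhile (\<lambda>x. x < a + i) g = take q g"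
    unfolding q by (metis takeWhile_eq_take)
  have 1: "?G ! y < a + i" if "y < a + q" for y
  proof (cases "y < a")
    case False
    then have "g ! (y - a) = takeWhile (\<lambda>x. x < a + i) g ! (y - a)"
      using that q by (simp add: takeWhile_nth)
    moreover have "\<dots> \<in> set (takeWhile (\<lambda>x. x < a + i) g)"
      using that q False by (intro nth_mem) auto
    ultimately show ?thesis using False by (auto simp: nth_append dest: set_takeWhileD)
  qed (simp add: nth_append)
  have 2: "\<not> ?G ! (a + q) < a + i"
    using nth_length_takeWhile[of "\<lambda>x. x < a + i" g] q by (simp add: nth_append)
  have "takeWhile (\<lambda>x. x < a + i) (wsubst a g w) =
      wsubst a g (takeWhile (\<lambda>y. ?G ! y < a + i) w)"
    by (simp add: wsubst_def takeWhile_map comp_def)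
  also have "takeWhile (\<lambda>y. ?G ! y < a + i) w = takeWhile (\<lambda>y. y < a + q) w"
    using 1 2 by (intro takeWhile_pword[OF w]) auto
  also have "wsubst a g \<dots> = wsubst a (take q g @ drop q g) (takeWhile (\<lambda>y. y < a + q) w)"
    by simp
  also have "\<dots> = wsubst a (take q g) (takeWhile (\<lambda>y. y < a + q) w)"
    using q by (intro wsubst_extend) (auto dest: set_takeWhileD)
  finally show ?thesis unfolding t
    using q by (simp, intro wsubst_wsubst) (auto dest: set_takeWhileD)
qed

section \<open>The Graham-Rothschild theorem\<close>

lemma finite_words: "finite {u. length u = n \<and> set u \<subseteq> {..<a::nat}}"
  using finite_lists_length_eq[of "{..<a}" n] by (simp add: conj_commute)

text \<open>\<open>\<psi>'\<close> numbers the vectors of colors indexed by \<open>Y\<close>. The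
  bound \<open>R\<close> is the number of such vectors and is fixed before \<open>\<psi>\<close>, so
  it can serve as the number of colors in another Ramsey statement.\<close>

lemma product_coloring:
  fixes Y :: "'y set" and r :: nat
  assumes "finite Y"
  obtains R where "\<And>\<psi> :: 'y \<Rightarrow> 'x \<Rightarrow> nat. (\<And>y x. \<psi> y x < r) \<Longrightarrow>
    \<exists>\<psi>' :: 'x \<Rightarrow> nat. (\<forall>x. \<psi>' x < R) \<and> (\<forall>x x'. \<psi>' x = \<psi>' x' \<longrightarrow> (\<forall>y\<in>Y. \<psi> y x = \<psi> y x'))"
proof -
  have fin: "finite (Y \<rightarrow>\<^sub>E {..<r})" using assms by (simp add: finite_PiE)
  then obtain e :: "('y \<Rightarrow> nat) \<Rightarrow> nat" where e: "bij_betw e (Y \<rightarrow>\<^sub>E {..<r}) {0..<card (Y \<rightarrow>\<^sub>E {..<r})}"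
    using ex_bij_betw_finite_nat by blast
  show thesis
  proof (rule that)
    fix \<psi> :: "'y \<Rightarrow> 'x \<Rightarrow> nat" assume \<psi>: "\<And>y x. \<psi> y x < r"
    let ?v = "\<lambda>x. \<lambda>y\<in>Y. \<psi> y x"
    have v: "?v x \<in> Y \<rightarrow>\<^sub>E {..<r}" for x using \<psi> by auto
    show "\<exists>\<psi>' :: 'x \<Rightarrow> nat. (\<forall>x. \<psi>' x < card (Y \<rightarrow>\<^sub>E {..<r})) \<and>
        (\<forall>x x'. \<psi>' x = \<psi>' x' \<longrightarrow> (\<forall>y\<in>Y. \<psi> y x = \<psi> y x'))"
    proof (intro exI[of _ "\<lambda>x. e (?v x)"] conjI allI impI ballI)
      show "e (?v x) < card (Y \<rightarrow>\<^sub>E {..<r})" for x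
        using bij_betw_apply[OF e v] by simp
      fix x x' y assume "e (?v x) = e (?v x')" and y: "y \<in> Y"
      then have "?v x = ?v x'" using e v by (metis bij_betw_imp_inj_on inj_onD)
      from fun_cong[OF this, of y] y show "\<psi> y x = \<psi> y x'" by simp
    qed
  qed
qed

text \<open>
  \<open>GR a a\<close> is the multidimensional Hales-Jewett theorem for an alphabet of \<open>a\<close> letters.
\<close>

definition GR :: "nat \<Rightarrow> nat \<Rightarrow> bool" where
  "GR a k \<longleftrightarrow> (\<forall>m r. \<exists>N. \<forall>\<psi> :: nat list \<Rightarrow> nat. (\<forall>t. \<psi> t < r) \<longrightarrow>
     (\<exists>g. pword a (a + m) g \<and> length g = N \<and>
       (\<exists>c. \<forall>h. length h = m \<longrightarrow> pword a k h \<longrightarrow> \<psi> (wsubst a h g) = c)))"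

lemma GRE:
  assumes "GR a k"
  obtains N where "\<And>\<psi> :: nat list \<Rightarrow> nat. (\<And>t. \<psi> t < r) \<Longrightarrow>
     \<exists>g c. pword a (a + m) g \<and> length g = N \<and>
       (\<forall>h. length h = m \<longrightarrow> pword a k h \<longrightarrow> \<psi> (wsubst a h g) = c)"
proof -
  from assms[unfolded GR_def, THEN spec, THEN spec, of r m] obtain N
    where N: "\<forall>\<psi> :: nat list \<Rightarrow> nat. (\<forall>t. \<psi> t < r) \<longrightarrow>
     (\<exists>g. pword a (a + m) g \<and> length g = N \<and>
       (\<exists>c. \<forall>h. length h = m \<longrightarrow> pword a k h \<longrightarrow> \<psi> (wsubst a h g) = c))" by (elim exE)
  show thesis
  proof (rule that)
    fix \<psi> :: "nat list \<Rightarrow> nat" assume "\<And>t. \<psi> t < r"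
    then have "\<forall>t. \<psi> t < r" ..
    from N[THEN spec, THEN mp, OF this]
    show "\<exists>g c. pword a (a + m) g \<and> length g = N \<and>
       (\<forall>h. length h = m \<longrightarrow> pword a k h \<longrightarrow> \<psi> (wsubst a h g) = c)"
      by (elim exE conjE) (intro exI conjI)
  qed
qed

text \<open>
  Shelah's step: in the new block the words \<open>(a - 1)\<^sup>i a\<^sup>L\<^sup>-\<^sup>i\<close> are more numerous than the colorings
  they induce on the preceding blocks, and two of them that agree are joined by a parameter.
\<close>

lemma insensitive:
  assumes "a > 0"
  shows "\<exists>N. \<forall>\<psi> :: nat list \<Rightarrow> nat. (\<forall>t. \<psi> t < r) \<longrightarrow>
     (\<exists>g. pword (Suc a) (Suc a + n) g \<and> length g = N \<and>
       (\<forall>h. length h = n \<longrightarrow> set h \<subseteq> {..<Suc a} \<longrightarrow>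
         \<psi> (wsubst (Suc a) h g) = \<psi> (wsubst (Suc a) (map (min (a - 1)) h) g)))"
proof (induction n arbitrary: r)
  case 0
  show ?case by (intro exI[of _ 0] allI impI exI[of _ "[]"]) (auto simp: wsubst_def)
next
  case (Suc n)
  let ?W = "\<lambda>n. {u. length u = n \<and> set u \<subseteq> {..<Suc a}}"
  \<comment> \<open>\<open>L\<close> is both the number of induced colors and the length of the new
    block: the block offers \<open>L + 1\<close> words \<open>y 0, ..., y L\<close>, one more than
    there are colors.\<close>
  obtain L where L: "\<And>\<psi> :: nat list \<Rightarrow> nat \<Rightarrow> nat. (\<And>y x. \<psi> y x < r) \<Longrightarrow>
     \<exists>\<psi>' :: nat \<Rightarrow> nat. (\<forall>x. \<psi>' x < L) \<and> (\<forall>x x'. \<psi>' x = \<psi>' x' \<longrightarrow> (\<forall>y\<in>?W n. \<psi> y x = \<psi> y x'))"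
    by (rule product_coloring[OF finite_words]) blast
  \<comment> \<open>A color below \<open>R\<close> records the colors under all fillings of the last
    block, so the induction hypothesis holds whatever that block contains.\<close>
  obtain R where R: "\<And>\<psi> :: nat list \<Rightarrow> nat list \<Rightarrow> nat. (\<And>y x. \<psi> y x < r) \<Longrightarrow>
     \<exists>\<psi>' :: nat list \<Rightarrow> nat. (\<forall>x. \<psi>' x < R) \<and> (\<forall>x x'. \<psi>' x = \<psi>' x' \<longrightarrow> (\<forall>y\<in>?W L. \<psi> y x = \<psi> y x'))"
    by (rule product_coloring[OF finite_words]) blast
  from Suc[of R] obtain N where N: "\<forall>\<psi> :: nat list \<Rightarrow> nat. (\<forall>t. \<psi> t < R) \<longrightarrow>
     (\<exists>g. pword (Suc a) (Suc a + n) g \<and> length g = N \<and>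
       (\<forall>h. length h = n \<longrightarrow> set h \<subseteq> {..<Suc a} \<longrightarrow>
         \<psi> (wsubst (Suc a) h g) = \<psi> (wsubst (Suc a) (map (min (a - 1)) h) g)))"
    by (elim exE)
  show ?case
  proof (intro exI[of _ "N + L"] allI impI)
    fix \<psi> :: "nat list \<Rightarrow> nat" assume \<psi>: "\<forall>t. \<psi> t < r"
    obtain \<psi>1 :: "nat list \<Rightarrow> nat" where \<psi>1: "\<forall>x. \<psi>1 x < R"
      "\<forall>x x'. \<psi>1 x = \<psi>1 x' \<longrightarrow> (\<forall>y\<in>?W L. \<psi> (x @ y) = \<psi> (x' @ y))"
      using R[of "\<lambda>y x. \<psi> (x @ y)", OF spec[OF \<psi>]] by (elim exE conjE) (rule that)
    from N[THEN spec, THEN mp, OF \<psi>1(1)] obtain g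
      where g: "pword (Suc a) (Suc a + n) g" "length g = N"
      "\<forall>h. length h = n \<longrightarrow> set h \<subseteq> {..<Suc a} \<longrightarrow>
         \<psi>1 (wsubst (Suc a) h g) = \<psi>1 (wsubst (Suc a) (map (min (a - 1)) h) g)"
      by (elim exE conjE) (rule that)
    define y where "y i = replicate i (a - 1) @ replicate (L - i) a" for i
    obtain \<psi>2 :: "nat \<Rightarrow> nat" where \<psi>2: "\<forall>x. \<psi>2 x < L" "\<forall>i i'. \<psi>2 i = \<psi>2 i' \<longrightarrow>
        (\<forall>h\<in>?W n. \<psi> (wsubst (Suc a) h g @ y i) = \<psi> (wsubst (Suc a) h g @ y i'))"
      using L[of "\<lambda>h i. \<psi> (wsubst (Suc a) h g @ y i)", OF spec[OF \<psi>]] by (elim exE conjE) (rule that)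
    have "\<psi>2 ` {..L} \<subseteq> {..<L}" using \<psi>2(1) by auto
    from card_mono[OF _ this] have "\<not> inj_on \<psi>2 {..L}"
      by (intro pigeonhole) simp
    then obtain i j where ij: "i < j" "j \<le> L" "\<psi>2 i = \<psi>2 j"
      by (metis atMost_iff linorder_inj_onI')
    \<comment> \<open>\<open>y i\<close> and \<open>y j\<close> differ only at the positions from
      \<open>i\<close> to \<open>j - 1\<close>, where the former has \<open>a\<close> and the latter
      \<open>a - 1\<close>; the new parameter goes there.\<close>
    define z where "z x = replicate i (a - 1) @ replicate (j - i) x @ replicate (L - j) a" for x
    have za: "z a = y i" using ij
      by (simp add: z_def y_def flip: replicate_add)
    have zb: "z (a - 1) = y j" using ij
      by (simp add: z_def y_def flip: replicate_add append_assoc)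
    have pz: "pword (Suc a + n) (Suc a + Suc n) (z (Suc a + n))"
    proof -
      have "pword (Suc a + n) (Suc a + Suc n) ((Suc a + n) # replicate (j - i - 1) (Suc a + n) @ replicate (L - j) a)"
        by (auto simp: pword_const)
      also have "(Suc a + n) # replicate (j - i - 1) (Suc a + n) @ replicate (L - j) a
          = replicate (j - i) (Suc a + n) @ replicate (L - j) a"
        using ij by (cases "j - i") auto
      finally show ?thesis unfolding z_def
        by (subst pword_const_append) auto
    qed
    show "\<exists>g. pword (Suc a) (Suc a + Suc n) g \<and> length g = N + L \<and>
       (\<forall>h. length h = Suc n \<longrightarrow> set h \<subseteq> {..<Suc a} \<longrightarrow>
         \<psi> (wsubst (Suc a) h g) = \<psi> (wsubst (Suc a) (map (min (a - 1)) h) g))"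
    proof (intro exI[of _ "g @ z (Suc a + n)"] conjI allI impI)
      show "pword (Suc a) (Suc a + Suc n) (g @ z (Suc a + n))"
        using g(1) pz by (auto simp: pword_append)
      show "length (g @ z (Suc a + n)) = N + L" using g ij by (simp add: z_def)
      fix h assume "length h = Suc n" and hs: "set h \<subseteq> {..<Suc a}"
      then obtain h0 x where h: "h = h0 @ [x]" "length h0 = n"
        by (metis length_Suc_conv_rev)
      have x: "x \<le> a" and h0: "set h0 \<subseteq> {..<Suc a}" using hs h by auto
      have w: "wsubst (Suc a) (h0' @ [x']) (g @ z (Suc a + n)) = wsubst (Suc a) h0' g @ z x'"
        if "length h0' = n" for h0' x'
      proof -
        have "wsubst (Suc a) (h0' @ [x']) g = wsubst (Suc a) h0' g"
          using pword_bounds(2)[OF g(1)] that by (intro wsubst_extend) auto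
        moreover have "wsubst (Suc a) (h0' @ [x']) (z (Suc a + n)) = z x'"
          using that by (auto simp: wsubst_def z_def nth_append)
        ultimately show ?thesis by (simp add: wsubst_append)
      qed
      let ?h = "map (min (a - 1)) h0"
      have zW: "z x \<in> ?W L" using x ij assms by (auto simp: z_def)
      have hW: "?h \<in> ?W n" using h by auto
      \<comment> \<open>The letters are changed in two moves: those of \<open>h0\<close> by the
        insensitivity of \<open>g\<close>, then the last one by the coincidence of
        \<open>y i\<close> and \<open>y j\<close>.\<close>
      have "\<psi> (wsubst (Suc a) h (g @ z (Suc a + n))) = \<psi> (wsubst (Suc a) h0 g @ z x)"
        using w h by simp
      also have "\<dots> = \<psi> (wsubst (Suc a) ?h g @ z x)"
        using \<psi>1(2)[rule_format, OF g(3)[rule_format, OF h(2) h0] zW] .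
      also have "\<dots> = \<psi> (wsubst (Suc a) ?h g @ z (min (a - 1) x))"
      proof (cases "x = a")
        case True
        from \<psi>2(2)[rule_format, OF ij(3) hW] have "\<psi> (wsubst (Suc a) ?h g @ y i) = \<psi> (wsubst (Suc a) ?h g @ y j)" .
        with True show ?thesis using za zb by simp
      next
        case False
        then have "min (a - 1) x = x" using x by auto
        then show ?thesis by simp
      qed
      also have "\<dots> = \<psi> (wsubst (Suc a) (map (min (a - 1)) h) (g @ z (Suc a + n)))"
        using w h by simp
      finally show "\<psi> (wsubst (Suc a) h (g @ z (Suc a + n))) =
        \<psi> (wsubst (Suc a) (map (min (a - 1)) h) (g @ z (Suc a + n)))" .
    qed
  qed
qed

text \<open>Induction on the size of the alphabet. In a subspace that does not distinguish the
  letter \<open>a\<close> from \<open>a - 1\<close>, every color is already attained by a word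
  without \<open>a\<close>, and such words are covered by the smaller alphabet.\<close>

lemma hales_jewett: "a > 0 \<Longrightarrow> GR a a"
proof (induction a rule: nat_induct_non_zero)
  case 1
  show ?case unfolding GR_def
  proof (intro allI)
    fix m r :: nat
    have "h = replicate m 0" if "length h = m" "pword 1 1 h" for h
      using that by (auto simp: pword_const list_eq_iff_nth_eq dest!: nth_mem)
    then show "\<exists>N. \<forall>\<psi> :: nat list \<Rightarrow> nat. (\<forall>t. \<psi> t < r) \<longrightarrow>
       (\<exists>g. pword 1 (1 + m) g \<and> length g = N \<and>
       (\<exists>c. \<forall>h. length h = m \<longrightarrow> pword 1 1 h \<longrightarrow> \<psi> (wsubst 1 h g) = c))"
      using pword_upt[of 1 m]
      by (intro exI[of _ m] allI impI exI[of _ "[1..<1 + m]"]) (metis add_diff_cancel_left' length_upt)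
  qed
next
  case (Suc a)
  show ?case unfolding GR_def
  proof (intro allI)
    fix m r :: nat
    obtain n where n: "\<And>\<psi> :: nat list \<Rightarrow> nat. (\<And>t. \<psi> t < r) \<Longrightarrow>
      \<exists>g c. pword a (a + m) g \<and> length g = n \<and>
        (\<forall>h. length h = m \<longrightarrow> pword a a h \<longrightarrow> \<psi> (wsubst a h g) = c)"
      using GRE[OF Suc.IH, of r m] by blast
    from insensitive[OF Suc.hyps, where r = r and n = n] obtain N where N: "\<forall>\<psi> :: nat list \<Rightarrow> nat. (\<forall>t. \<psi> t < r) \<longrightarrow>
      (\<exists>g. pword (Suc a) (Suc a + n) g \<and> length g = N \<and>
       (\<forall>h. length h = n \<longrightarrow> set h \<subseteq> {..<Suc a} \<longrightarrow>
         \<psi> (wsubst (Suc a) h g) = \<psi> (wsubst (Suc a) (map (min (a - 1)) h) g)))"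
      by (elim exE)
    show "\<exists>N. \<forall>\<psi> :: nat list \<Rightarrow> nat. (\<forall>t. \<psi> t < r) \<longrightarrow>
       (\<exists>g. pword (Suc a) (Suc a + m) g \<and> length g = N \<and>
       (\<exists>c. \<forall>h. length h = m \<longrightarrow> pword (Suc a) (Suc a) h \<longrightarrow> \<psi> (wsubst (Suc a) h g) = c))"
    proof (intro exI[of _ N] allI impI)
      fix \<psi> :: "nat list \<Rightarrow> nat" assume \<psi>: "\<forall>t. \<psi> t < r"
      from N[THEN spec, THEN mp, OF \<psi>] obtain g1 where
        g1: "pword (Suc a) (Suc a + n) g1" "length g1 = N"
        "\<forall>h. length h = n \<longrightarrow> set h \<subseteq> {..<Suc a} \<longrightarrow>
         \<psi> (wsubst (Suc a) h g1) = \<psi> (wsubst (Suc a) (map (min (a - 1)) h) g1)"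
        by (elim exE conjE) (rule that)
      from n[of "\<lambda>t. \<psi> (wsubst (Suc a) t g1)", OF spec[OF \<psi>]] obtain g2 c where
        g2: "pword a (a + m) g2" "length g2 = n" and
        c: "\<forall>h. length h = m \<longrightarrow> pword a a h \<longrightarrow> \<psi> (wsubst (Suc a) (wsubst a h g2) g1) = c"
        by (elim exE conjE) (rule that)
      \<comment> \<open>Raising the parameters by one frees the number \<open>a\<close> for the
        additional constant, which does not occur in \<open>g\<close>.\<close>
      define g where "g = map (\<lambda>x. if x < a then x else Suc x) g2"
      have "pword (Suc b) (Suc k) (map (\<lambda>x. if x < a then x else Suc x) t)"
        if "pword b k t" "a \<le> b" for b k t
        using that by (induction b k t rule: pword.induct) auto
      from this[OF g2(1)] have g: "pword (Suc a) (Suc a + m) g" "length g = n"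
        using g2 by (auto simp: g_def)
      have gs: "wsubst (Suc a) h g = wsubst a h g2" for h
        by (auto simp: wsubst_def g_def nth_append)
      \<comment> \<open>The constants of \<open>g2\<close> lie below \<open>a\<close> and are fixed
        by \<open>min (a - 1)\<close>, so only the substituted letters are affected.\<close>
      have gm: "map (min (a - 1)) (wsubst a h g2) = wsubst a (map (min (a - 1)) h) g2"
        if "length h = m" for h
        using that pword_bounds(2)[OF g2(1)]
        by (auto simp: wsubst_def nth_append)
      show "\<exists>g. pword (Suc a) (Suc a + m) g \<and> length g = N \<and>
       (\<exists>c. \<forall>h. length h = m \<longrightarrow> pword (Suc a) (Suc a) h \<longrightarrow> \<psi> (wsubst (Suc a) h g) = c)"
      proof (intro exI[of _ "wsubst (Suc a) g g1"] conjI exI[of _ c] allI impI)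
        show "pword (Suc a) (Suc a + m) (wsubst (Suc a) g g1)"
          using g g1 by (intro pword_wsubst) auto
        show "length (wsubst (Suc a) g g1) = N" using g1 by simp
        fix h assume h: "length h = m" "pword (Suc a) (Suc a) h"
        have "wsubst (Suc a) h (wsubst (Suc a) g g1) = wsubst (Suc a) (wsubst a h g2) g1"
          using pword_bounds(2)[OF g1(1)] g(2) by (subst wsubst_wsubst) (auto simp: gs)
        moreover have "set (wsubst a h g2) \<subseteq> {..<Suc a}"
          using pword_bounds(2)[OF g2(1)] h by (intro set_wsubst) (auto simp: pword_const)
        ultimately have "\<psi> (wsubst (Suc a) h (wsubst (Suc a) g g1)) =
            \<psi> (wsubst (Suc a) (wsubst a (map (min (a - 1)) h) g2) g1)"
          using g1(3)[THEN spec, of "wsubst a h g2"] g2(2) gm[OF h(1)] by simp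
        also have "\<dots> = c"
        proof (rule c[rule_format])
          show "pword a a (map (min (a - 1)) h)"
            using Suc.hyps by (auto simp: pword_const)
        qed (use h in simp)
        finally show "\<psi> (wsubst (Suc a) h (wsubst (Suc a) g g1)) = c" .
      qed
    qed
  qed
qed

section \<open>Making the color of a cut word constant\<close>

text \<open>The cut before parameter \<open>a + i\<close> involves exactly \<open>i\<close>
  parameters, so Hales-Jewett handles each length separately. In the induction the new, longest
  length is served first: \<open>w\<close> is taken of dimension \<open>D\<close>, the word length
  that the shorter ones require, and these are then treated inside \<open>w\<close>.\<close>

lemma cut_colors:
  assumes "a > 0"
  shows "\<exists>M. \<forall>\<psi> :: nat list \<Rightarrow> nat. (\<forall>t. \<psi> t < r) \<longrightarrow>
    (\<exists>g. pword a (a + m) g \<and> length g = M \<and> (\<forall>i<m. \<exists>c. \<forall>u. length u = i \<longrightarrow> set u \<subseteq> {..<a} \<longrightarrow>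
       \<psi> (wsubst a u (takeWhile (\<lambda>x. x < a + i) g)) = c))"
proof (induction m)
  case 0
  show ?case by (intro exI[of _ 0] allI impI exI[of _ "[]"]) auto
next
  case (Suc m)
  then obtain D where D: "\<forall>\<psi> :: nat list \<Rightarrow> nat. (\<forall>t. \<psi> t < r) \<longrightarrow>
    (\<exists>g. pword a (a + m) g \<and> length g = D \<and> (\<forall>i<m. \<exists>c. \<forall>u. length u = i \<longrightarrow> set u \<subseteq> {..<a} \<longrightarrow>
       \<psi> (wsubst a u (takeWhile (\<lambda>x. x < a + i) g)) = c))"
    by (elim exE)
  obtain L where L: "\<And>\<psi> :: nat list \<Rightarrow> nat. (\<And>t. \<psi> t < r) \<Longrightarrow>
      \<exists>g c. pword a (a + D) g \<and> length g = L \<and>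
        (\<forall>h. length h = D \<longrightarrow> pword a a h \<longrightarrow> \<psi> (wsubst a h g) = c)"
    using GRE[OF hales_jewett[OF assms], of r D] by blast
  show ?case
  proof (intro exI[of _ "Suc L"] allI impI)
    fix \<psi> :: "nat list \<Rightarrow> nat" assume \<psi>: "\<forall>t. \<psi> t < r"
    from L[of \<psi>, OF spec[OF \<psi>]] obtain w c where
      w: "pword a (a + D) w" "length w = L" and
      c: "\<forall>h. length h = D \<longrightarrow> pword a a h \<longrightarrow> \<psi> (wsubst a h w) = c"
      by (elim exE conjE) (rule that)
    \<comment> \<open>The coloring passed to the induction hypothesis: a word is put into
      \<open>w\<close> cut at its own length. By \<open>cut_wsubst\<close> these are the cuts of the
      composite.\<close>
    have "\<forall>x. \<psi> (wsubst a x (takeWhile (\<lambda>y. y < a + length x) w)) < r" using \<psi> by simp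
    from D[THEN spec, THEN mp, OF this] obtain g where
      g: "pword a (a + m) g" "length g = D" and
      cg: "\<forall>i<m. \<exists>c. \<forall>u. length u = i \<longrightarrow> set u \<subseteq> {..<a} \<longrightarrow>
       \<psi> (wsubst a (wsubst a u (takeWhile (\<lambda>x. x < a + i) g))
         (takeWhile (\<lambda>y. y < a + length (wsubst a u (takeWhile (\<lambda>x. x < a + i) g))) w)) = c"
      by (elim exE conjE) (rule that)
    \<comment> \<open>The additional parameter stands at the very end, so the cut before it is the
      whole of \<open>wsubst a g w\<close>; this is the one letter added to the length
      \<open>L\<close>.\<close>
    let ?G = "wsubst a g w @ [a + m]"
    have gw: "pword a (a + m) (wsubst a g w)" using g w by (intro pword_wsubst) auto
    show "\<exists>g. pword a (a + Suc m) g \<and> length g = Suc L \<and>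
      (\<forall>i<Suc m. \<exists>c. \<forall>u. length u = i \<longrightarrow> set u \<subseteq> {..<a} \<longrightarrow>
       \<psi> (wsubst a u (takeWhile (\<lambda>x. x < a + i) g)) = c)"
    proof (intro exI[of _ ?G] conjI allI impI)
      show "pword a (a + Suc m) ?G" using gw by (auto simp: pword_append)
      show "length ?G = Suc L" using w by simp
      fix i assume "i < Suc m"
      have cut: "takeWhile (\<lambda>x. x < a + i) ?G = takeWhile (\<lambda>x. x < a + i) (wsubst a g w)"
        using \<open>i < Suc m\<close> by (simp add: takeWhile_tail)
      show "\<exists>c. \<forall>u. length u = i \<longrightarrow> set u \<subseteq> {..<a} \<longrightarrow>
        \<psi> (wsubst a u (takeWhile (\<lambda>x. x < a + i) ?G)) = c"
      proof (cases "i = m")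
        case True
        have "takeWhile (\<lambda>x. x < a + i) (wsubst a g w) = wsubst a g w"
          using pword_bounds(2)[OF gw] True by (auto simp: takeWhile_eq_all_conv)
        moreover have "\<psi> (wsubst a u (wsubst a g w)) = c" if u: "length u = i" "set u \<subseteq> {..<a}" for u
        proof -
          have "wsubst a u (wsubst a g w) = wsubst a (wsubst a u g) w"
            using pword_bounds(2)[OF w(1)] g by (intro wsubst_wsubst) auto
          moreover have "pword a a (wsubst a u g)"
            using g u True by (intro pword_wsubst) (auto simp: pword_const)
          ultimately show ?thesis using c g by simp
        qed
        ultimately show ?thesis unfolding cut by metis
      next
        case False
        then have i: "i < m" using \<open>i < Suc m\<close> by simp
        have "takeWhile (\<lambda>x. x < a + i) g \<noteq> g"
        proof
          assume "takeWhile (\<lambda>x. x < a + i) g = g"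
          then have "set g \<subseteq> {..<a + i}" by (metis lessThan_iff set_takeWhileD subsetI)
          moreover have "a + i \<in> set g" using pword_surj[OF g(1)] i
            by (metis Un_iff add_less_cancel_left lessThan_iff not_add_less1)
          ultimately show False by auto
        qed
        then have q: "length (takeWhile (\<lambda>x. x < a + i) g) < length g"
          by (metis length_takeWhile_le nat_less_le takeWhile_eq_take take_all order_refl)
        from cg[rule_format, OF i] obtain c' where c': "\<forall>u. length u = i \<longrightarrow> set u \<subseteq> {..<a} \<longrightarrow>
         \<psi> (wsubst a (wsubst a u (takeWhile (\<lambda>x. x < a + i) g))
         (takeWhile (\<lambda>y. y < a + length (wsubst a u (takeWhile (\<lambda>x. x < a + i) g))) w)) = c'"
          by (elim exE)
        then show ?thesis unfolding cut
          using cut_wsubst[OF w(1) _ refl q] by (intro exI[of _ c']) auto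
      qed
    qed
  qed
qed

text \<open>A device for thinning out parameters: the marks will single out the levels with a
  popular color, of which the first \<open>m\<close> stay free while all other coordinates are
  frozen at 0.\<close>

fun select :: "nat \<Rightarrow> nat \<Rightarrow> bool list \<Rightarrow> nat list" where
  "select a m [] = []"
| "select a 0 (b # bs) = 0 # select a 0 bs"
| "select a (Suc m) (b # bs) = (if b then a # select (Suc a) m bs else 0 # select a (Suc m) bs)"

lemma length_select [simp]: "length (select a m bs) = length bs"
  by (induction a m bs rule: select.induct) auto

lemma pword_select:
  assumes "m \<le> length (filter id bs)" "a > 0"
  shows "pword a (a + m) (select a m bs)"
  using assms by (induction a m bs rule: select.induct) (auto split: if_splits)

text \<open>Every letter other than a parameter is 0, hence below \<open>a\<close>, so a cut can
  only end where a parameter was placed, which is at a mark.\<close>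

lemma select_position:
  assumes "i < m" "m \<le> length (filter id bs)" "a > 0"
    and "q = length (takeWhile (\<lambda>x. x < a + i) (select a m bs))"
  shows "q < length bs \<and> bs ! q"
  using assms
proof (induction a m bs arbitrary: i q rule: select.induct)
  case (3 a m b bs)
  show ?case
  proof (cases "b \<and> i > 0")
    case True
    then obtain i' where "i = Suc i'" by (cases i) auto
    with "3.IH"(1)[of i' "q - 1"] 3 True show ?thesis by auto
  next
    case False
    show ?thesis
    proof (cases b)
      case True
      then show ?thesis using False 3 by auto
    next
      case False
      with "3.IH"(2)[of i "q - 1"] 3 show ?thesis by auto
    qed
  qed
qed auto

lemma pigeonhole_list:
  assumes "set xs \<subseteq> {..<r::nat}" "length xs \<ge> m * r" "r > 0"
  shows "\<exists>c. m \<le> count_list xs c"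
proof (rule ccontr)
  assume "\<not> ?thesis"
  then have less: "count_list xs c < m" for c
    by (simp add: not_le)
  have "length xs = (\<Sum>c<r. count_list xs c)"
    using sum_count_set[OF assms(1)] by simp
  also have "\<dots> < (\<Sum>c<r. m)"
    using less assms(3) by (intro sum_strict_mono) auto
  also have "\<dots> = m * r" by simp
  finally show False using assms(2) by simp
qed

text \<open>Removes the dependence on the length left by \<open>cut_colors\<close>: among
  \<open>m * r\<close> levels some color occurs at least \<open>m\<close> times. Substituting
  \<open>select\<close> keeps only levels of that color, since \<open>cut_wsubst\<close> turns a cut
  of the new word into a cut of \<open>w\<close> at a marked level.\<close>

lemma cut_color:
  assumes "a > 0"
  shows "\<exists>M. \<forall>\<psi> :: nat list \<Rightarrow> nat. (\<forall>t. \<psi> t < r) \<longrightarrow>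
    (\<exists>g. pword a (a + m) g \<and> length g = M \<and> (\<exists>c. \<forall>u. length u < m \<longrightarrow> set u \<subseteq> {..<a} \<longrightarrow>
       \<psi> (wsubst a u (takeWhile (\<lambda>x. x < a + length u) g)) = c))"
proof -
  let ?D = "m * r"
  from cut_colors[OF assms, of r ?D] obtain M where M: "\<forall>\<psi> :: nat list \<Rightarrow> nat. (\<forall>t. \<psi> t < r) \<longrightarrow>
    (\<exists>g. pword a (a + ?D) g \<and> length g = M \<and> (\<forall>i<?D. \<exists>c. \<forall>u. length u = i \<longrightarrow> set u \<subseteq> {..<a} \<longrightarrow>
       \<psi> (wsubst a u (takeWhile (\<lambda>x. x < a + i) g)) = c))"
    by (elim exE)
  show ?thesis
  proof (intro exI[of _ M] allI impI)
    fix \<psi> :: "nat list \<Rightarrow> nat" assume \<psi>: "\<forall>t. \<psi> t < r"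
    from M[THEN spec, THEN mp, OF \<psi>] obtain w where
      w: "pword a (a + ?D) w" "length w = M" and
      ex: "\<forall>i<?D. \<exists>c. \<forall>u. length u = i \<longrightarrow> set u \<subseteq> {..<a} \<longrightarrow>
       \<psi> (wsubst a u (takeWhile (\<lambda>x. x < a + i) w)) = c"
      by (elim exE conjE) (rule that)
    \<comment> \<open>The color of level \<open>i\<close> is read off at the word of zeros, a
      constant word because \<open>a > 0\<close>.\<close>
    define \<gamma> where "\<gamma> i = \<psi> (wsubst a (replicate i 0) (takeWhile (\<lambda>x. x < a + i) w))" for i
    have \<gamma>: "\<psi> (wsubst a u (takeWhile (\<lambda>x. x < a + i) w)) = \<gamma> i"
      if "i < ?D" "length u = i" "set u \<subseteq> {..<a}" for i u
    proof -
      have "length (replicate i (0::nat)) = i" "set (replicate i 0) \<subseteq> {..<a}"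
        using assms by auto
      with ex[rule_format, OF that(1)] that(2,3) show ?thesis unfolding \<gamma>_def by metis
    qed
    have "r > 0" using \<psi> by (metis gr_zeroI not_less_zero)
    then have "\<exists>c. m \<le> count_list (map \<gamma> [0..<?D]) c"
      using \<psi> by (intro pigeonhole_list[of _ r]) (auto simp: \<gamma>_def)
    then obtain c where c: "m \<le> count_list (map \<gamma> [0..<?D]) c" ..
    define bs where "bs = map (\<lambda>i. c = \<gamma> i) [0..<?D]"
    have bs: "m \<le> length (filter id bs)" "length bs = ?D"
      using c by (simp_all add: bs_def filter_map comp_def count_list_eq_length_filter)
    let ?g = "select a m bs"
    note g = pword_select[OF bs(1) assms]
    show "\<exists>g. pword a (a + m) g \<and> length g = M \<and> (\<exists>c. \<forall>u. length u < m \<longrightarrow> set u \<subseteq> {..<a} \<longrightarrow>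
       \<psi> (wsubst a u (takeWhile (\<lambda>x. x < a + length u) g)) = c)"
    proof (intro exI[of _ "wsubst a ?g w"] exI[of _ c] conjI allI impI)
      show "pword a (a + m) (wsubst a ?g w)" using w g bs by (intro pword_wsubst) auto
      show "length (wsubst a ?g w) = M" using w by simp
      fix u :: "nat list" assume u: "length u < m" "set u \<subseteq> {..<a}"
      define q where "q = length (takeWhile (\<lambda>x. x < a + length u) ?g)"
      have q: "q < ?D" "\<gamma> q = c"
        using select_position[OF u(1) bs(1) assms q_def] by (auto simp: bs_def)
      have "wsubst a u (takeWhile (\<lambda>x. x < a + length u) (wsubst a ?g w)) =
        wsubst a (wsubst a u (takeWhile (\<lambda>x. x < a + length u) ?g)) (takeWhile (\<lambda>x. x < a + q) w)"
        using q bs by (intro cut_wsubst[OF w(1) refl q_def]) auto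
      moreover have "set (wsubst a u (takeWhile (\<lambda>x. x < a + length u) ?g)) \<subseteq> {..<a}"
        using u by (intro set_wsubst) (auto dest: set_takeWhileD)
      ultimately show "\<psi> (wsubst a u (takeWhile (\<lambda>x. x < a + length u) (wsubst a ?g w))) = c"
        using \<gamma>[OF q(1)] q(2) by (simp add: q_def)
    qed
  qed
qed

text \<open>
  The fusion step: along a suitable subspace the color of a word depends only on the part before its
  first parameter, because the part after it is a word with one more constant and one parameter less.
\<close>

lemma prefix_colors:
  assumes "a > 0" "GR (Suc a) k"
  shows "\<exists>N. \<forall>\<psi> :: nat list \<Rightarrow> nat. (\<forall>t. \<psi> t < r) \<longrightarrow>
    (\<exists>g. pword a (a + M) g \<and> length g = N \<and> (\<forall>u t t'. length u < j \<longrightarrow> set u \<subseteq> {..<a} \<longrightarrow>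
      length u + Suc (length t) = M \<longrightarrow> length u + Suc (length t') = M \<longrightarrow>
      pword (Suc a) k t \<longrightarrow> pword (Suc a) k t' \<longrightarrow>
      \<psi> (wsubst a (u @ a # t) g) = \<psi> (wsubst a (u @ a # t') g)))"
proof (induction j arbitrary: M)
  case 0
  show ?case using pword_upt[of a M]
    by (intro exI[of _ M] allI impI exI[of _ "[a..<a + M]"]) auto
next
  case (Suc j)
  show ?case
  \<comment> \<open>A prefix of length \<open>j\<close> followed by a parameter needs
    \<open>M > j\<close>; otherwise no new prefix has to be treated.\<close>
  proof (cases "M \<le> j")
    case True
    from Suc[of M] obtain N where N: "\<forall>\<psi> :: nat list \<Rightarrow> nat. (\<forall>t. \<psi> t < r) \<longrightarrow>
    (\<exists>g. pword a (a + M) g \<and> length g = N \<and> (\<forall>u t t'. length u < j \<longrightarrow> set u \<subseteq> {..<a} \<longrightarrow>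
      length u + Suc (length t) = M \<longrightarrow> length u + Suc (length t') = M \<longrightarrow>
      pword (Suc a) k t \<longrightarrow> pword (Suc a) k t' \<longrightarrow>
      \<psi> (wsubst a (u @ a # t) g) = \<psi> (wsubst a (u @ a # t') g)))" by (elim exE)
    have "length u < j" if "length u + Suc (length t) = M" for u t :: "nat list"
      using that True by auto
    with N show ?thesis by (intro exI[of _ N]) meson
  next
    case False
    define M' where "M' = M - Suc j"
    have M: "M = Suc j + M'" using False by (simp add: M'_def)
    let ?W = "{u. length u = j \<and> set u \<subseteq> {..<a}}"
    obtain R where R: "\<And>\<psi> :: nat list \<Rightarrow> nat list \<Rightarrow> nat. (\<And>y x. \<psi> y x < r) \<Longrightarrow>
     \<exists>\<psi>' :: nat list \<Rightarrow> nat. (\<forall>x. \<psi>' x < R) \<and> (\<forall>x x'. \<psi>' x = \<psi>' x' \<longrightarrow> (\<forall>y\<in>?W. \<psi> y x = \<psi> y x'))"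
      by (rule product_coloring[OF finite_words]) blast
    \<comment> \<open>After a prefix of length \<open>j\<close> and the first parameter,
      \<open>M'\<close> letters remain. They are spread over \<open>D\<close> positions, which is
      why the induction hypothesis is called with length \<open>Suc j + D\<close> in place of
      \<open>M\<close>.\<close>
    obtain D where D: "\<And>\<psi> :: nat list \<Rightarrow> nat. (\<And>t. \<psi> t < R) \<Longrightarrow>
      \<exists>g c. pword (Suc a) (Suc a + M') g \<and> length g = D \<and>
        (\<forall>h. length h = M' \<longrightarrow> pword (Suc a) k h \<longrightarrow> \<psi> (wsubst (Suc a) h g) = c)"
      using GRE[OF assms(2), of R M'] by blast
    let ?M = "Suc j + D"
    from Suc[of ?M] obtain N where N: "\<forall>\<psi> :: nat list \<Rightarrow> nat. (\<forall>t. \<psi> t < r) \<longrightarrow>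
    (\<exists>g. pword a (a + ?M) g \<and> length g = N \<and> (\<forall>u t t'. length u < j \<longrightarrow> set u \<subseteq> {..<a} \<longrightarrow>
      length u + Suc (length t) = ?M \<longrightarrow> length u + Suc (length t') = ?M \<longrightarrow>
      pword (Suc a) k t \<longrightarrow> pword (Suc a) k t' \<longrightarrow>
      \<psi> (wsubst a (u @ a # t) g) = \<psi> (wsubst a (u @ a # t') g)))" by (elim exE)
    show ?thesis
    proof (intro exI[of _ N] allI impI)
      fix \<psi> :: "nat list \<Rightarrow> nat" assume \<psi>: "\<forall>t. \<psi> t < r"
      from N[THEN spec, THEN mp, OF \<psi>] obtain g1 where g1: "pword a (a + ?M) g1" "length g1 = N"
        "\<forall>u t t'. length u < j \<longrightarrow> set u \<subseteq> {..<a} \<longrightarrow>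
          length u + Suc (length t) = ?M \<longrightarrow> length u + Suc (length t') = ?M \<longrightarrow>
          pword (Suc a) k t \<longrightarrow> pword (Suc a) k t' \<longrightarrow>
          \<psi> (wsubst a (u @ a # t) g1) = \<psi> (wsubst a (u @ a # t') g1)"
        by (elim exE conjE) (rule that)
      obtain \<psi>1 :: "nat list \<Rightarrow> nat" where \<psi>1: "\<forall>x. \<psi>1 x < R"
        "\<forall>x x'. \<psi>1 x = \<psi>1 x' \<longrightarrow> (\<forall>y\<in>?W. \<psi> (wsubst a (y @ a # x) g1) = \<psi> (wsubst a (y @ a # x') g1))"
        using R[of "\<lambda>u t. \<psi> (wsubst a (u @ a # t) g1)", OF spec[OF \<psi>]]
        by (elim exE conjE) (rule that)
      from D[of \<psi>1, OF spec[OF \<psi>1(1)]] obtain g2 c where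
        g2: "pword (Suc a) (Suc a + M') g2" "length g2 = D" and
        c: "\<forall>h. length h = M' \<longrightarrow> pword (Suc a) k h \<longrightarrow> \<psi>1 (wsubst (Suc a) h g2) = c"
        by (elim exE conjE) (rule that)
      \<comment> \<open>In \<open>g2\<close> the letter \<open>a\<close> stands for the first
        parameter. In \<open>g\<close> the numbers from \<open>a\<close> to \<open>a + j - 1\<close>
        belong to the \<open>j\<close> free positions of the prefix, so everything from
        \<open>a\<close> on moves up by \<open>j\<close>.\<close>
      define \<theta> where "\<theta> x = (if x < a then x else x + j)" for x
      define g where "g = [a..<a + j] @ (a + j) # map \<theta> g2"
      have "pword (b + j) (m + j) (map \<theta> t)" if "pword b m t" "Suc a \<le> b" for b m t
        using that by (induction b m t rule: pword.induct) (auto simp: \<theta>_def)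
      from this[OF g2(1)] have "pword (Suc (a + j)) (a + M) (map \<theta> g2)"
        by (simp add: M add_ac)
      then have g: "pword a (a + M) g"
        using pword_upt[of a j] by (auto simp: g_def pword_append)
      have lg: "length g = ?M" using g2 by (simp add: g_def)
      have sub: "wsubst a (u @ a # t) g = u @ a # wsubst (Suc a) t g2" if "length u = j" for u t
      proof -
        have "map ((!) ([0..<a] @ u @ a # t)) [a..<a + j] = u"
          using that by (auto simp: list_eq_iff_nth_eq nth_append)
        moreover have "([0..<a] @ u @ a # t) ! \<theta> x = ([0..<Suc a] @ t) ! x" for x
          using that by (auto simp: \<theta>_def nth_append nth_Cons' less_Suc_eq_le)
        ultimately show ?thesis using that by (simp add: g_def wsubst_def nth_append)
      qed
      \<comment> \<open>For a shorter prefix the leading positions of \<open>g\<close> still copy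
        \<open>u\<close> and the first parameter. The tail becomes some other admissible tail of the
        longer word, and for it the property of \<open>g1\<close> is known.\<close>
      have sub': "\<exists>s. wsubst a (u @ a # t) g = u @ a # s \<and> length u + Suc (length s) = ?M \<and>
          pword (Suc a) k s"
        if "length u < j" "set u \<subseteq> {..<a}" "pword (Suc a) k t" "length u + Suc (length t) = M" for u t
      proof -
        let ?s = "drop (Suc (length u)) (wsubst a (u @ a # t) g)"
        have "g = [a..<Suc (a + j)] @ map \<theta> g2" by (simp add: g_def)
        then have "take (Suc (length u)) g = [a..<Suc (a + length u)]"
          using that(1) by (simp add: take_upt del: upt_Suc)
        then have "take (Suc (length u)) (wsubst a (u @ a # t) g) =
            map ((!) ([0..<a] @ u @ a # t)) [a..<Suc (a + length u)]"
          by (simp add: wsubst_def take_map del: upt_Suc)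
        also have "\<dots> = u @ [a]"
          by (auto simp: list_eq_iff_nth_eq nth_append less_Suc_eq simp del: upt_Suc)
        finally have s: "wsubst a (u @ a # t) g = u @ a # ?s"
          using append_take_drop_id[of "Suc (length u)" "wsubst a (u @ a # t) g"] by simp
        have "pword a k (wsubst a (u @ a # t) g)"
          using that g by (intro pword_wsubst) (auto simp: pword_const_append)
        then have "pword a k (u @ a # ?s)" using s by simp
        then have "pword (Suc a) k ?s" using that(2) by (simp add: pword_const_append)
        with s show ?thesis using that(1) lg by (intro exI[of _ ?s]) simp
      qed
      show "\<exists>g. pword a (a + M) g \<and> length g = N \<and> (\<forall>u t t'. length u < Suc j \<longrightarrow> set u \<subseteq> {..<a} \<longrightarrow>
        length u + Suc (length t) = M \<longrightarrow> length u + Suc (length t') = M \<longrightarrow>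
        pword (Suc a) k t \<longrightarrow> pword (Suc a) k t' \<longrightarrow>
        \<psi> (wsubst a (u @ a # t) g) = \<psi> (wsubst a (u @ a # t') g))"
      proof (intro exI[of _ "wsubst a g g1"] conjI allI impI)
        show "pword a (a + M) (wsubst a g g1)" using g g1 lg by (intro pword_wsubst) auto
        show "length (wsubst a g g1) = N" using g1 by simp
        fix u t t' assume u: "length u < Suc j" "set u \<subseteq> {..<a}"
          and l: "length u + Suc (length t) = M" "length u + Suc (length t') = M"
          and t: "pword (Suc a) k t" "pword (Suc a) k t'"
        have ass: "wsubst a h (wsubst a g g1) = wsubst a (wsubst a h g) g1" for h
          using pword_bounds(2)[OF g1(1)] lg by (intro wsubst_wsubst) auto
        show "\<psi> (wsubst a (u @ a # t) (wsubst a g g1)) = \<psi> (wsubst a (u @ a # t') (wsubst a g g1))"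
        proof (cases "length u = j")
          case True
          then have "\<psi>1 (wsubst (Suc a) t g2) = \<psi>1 (wsubst (Suc a) t' g2)"
            using c t l M by simp
          from \<psi>1(2)[rule_format, OF this, of u] True u(2) show ?thesis
            unfolding ass sub[OF True] by simp
        next
          case False
          then have u': "length u < j" using u by simp
          from sub'[OF u' u(2) t(1) l(1)] obtain s where
            s: "wsubst a (u @ a # t) g = u @ a # s" "length u + Suc (length s) = ?M" "pword (Suc a) k s"
            by (elim exE conjE)
          from sub'[OF u' u(2) t(2) l(2)] obtain s' where
            s': "wsubst a (u @ a # t') g = u @ a # s'" "length u + Suc (length s') = ?M" "pword (Suc a) k s'"
            by (elim exE conjE)
          show ?thesis unfolding ass s(1) s'(1)
            by (rule g1(3)[rule_format, OF u' u(2) s(2) s'(2) s(3) s'(3)])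
        qed
      qed
    qed
  qed
qed

section \<open>The Graham-Rothschild induction\<close>

text \<open>As \<open>a < k\<close>, every word has a first parameter. Taking \<open>j = M\<close>
  in \<open>prefix_colors\<close> covers all prefixes of words of length \<open>M\<close>, so the
  color becomes a function of the prefix, and \<open>cut_color\<close> makes that function
  constant.\<close>

lemma GR_step:
  assumes "a > 0" "a < k" "GR (Suc a) k"
  shows "GR a k"
  unfolding GR_def
proof (intro allI)
  fix m r :: nat
  from cut_color[OF assms(1), where r = r and m = m] obtain M where M: "\<forall>\<psi> :: nat list \<Rightarrow> nat. (\<forall>t. \<psi> t < r) \<longrightarrow>
    (\<exists>g. pword a (a + m) g \<and> length g = M \<and> (\<exists>c. \<forall>u. length u < m \<longrightarrow> set u \<subseteq> {..<a} \<longrightarrow>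
       \<psi> (wsubst a u (takeWhile (\<lambda>x. x < a + length u) g)) = c))" by (elim exE)
  from prefix_colors[OF assms(1,3), where r = r and M = M and j = M] obtain N where N: "\<forall>\<psi> :: nat list \<Rightarrow> nat. (\<forall>t. \<psi> t < r) \<longrightarrow>
    (\<exists>g. pword a (a + M) g \<and> length g = N \<and> (\<forall>u t t'. length u < M \<longrightarrow> set u \<subseteq> {..<a} \<longrightarrow>
      length u + Suc (length t) = M \<longrightarrow> length u + Suc (length t') = M \<longrightarrow>
      pword (Suc a) k t \<longrightarrow> pword (Suc a) k t' \<longrightarrow>
      \<psi> (wsubst a (u @ a # t) g) = \<psi> (wsubst a (u @ a # t') g)))" by (elim exE)
  show "\<exists>N. \<forall>\<psi> :: nat list \<Rightarrow> nat. (\<forall>t. \<psi> t < r) \<longrightarrow>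
     (\<exists>g. pword a (a + m) g \<and> length g = N \<and>
       (\<exists>c. \<forall>h. length h = m \<longrightarrow> pword a k h \<longrightarrow> \<psi> (wsubst a h g) = c))"
  proof (intro exI[of _ N] allI impI)
    fix \<psi> :: "nat list \<Rightarrow> nat" assume \<psi>: "\<forall>t. \<psi> t < r"
    from N[THEN spec, THEN mp, OF \<psi>] obtain g1 where g1: "pword a (a + M) g1" "length g1 = N"
      "\<forall>u t t'. length u < M \<longrightarrow> set u \<subseteq> {..<a} \<longrightarrow>
      length u + Suc (length t) = M \<longrightarrow> length u + Suc (length t') = M \<longrightarrow>
      pword (Suc a) k t \<longrightarrow> pword (Suc a) k t' \<longrightarrow>
      \<psi> (wsubst a (u @ a # t) g1) = \<psi> (wsubst a (u @ a # t') g1)"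
      by (elim exE conjE) (rule that)
    \<comment> \<open>An arbitrary completion of the prefix; the color does not depend on the
      choice, by the property of \<open>g1\<close>. Where no completion exists the value is junk,
      which is harmless since \<open>\<psi>1\<close> only has to stay below
      \<open>r\<close>.\<close>
    define \<tau> where "\<tau> u = (SOME t. length u + Suc (length t) = M \<and> pword (Suc a) k t)" for u :: "nat list"
    define \<psi>1 where "\<psi>1 u = \<psi> (wsubst a (u @ a # \<tau> u) g1)" for u
    have "\<forall>u. \<psi>1 u < r" using \<psi> by (simp add: \<psi>1_def)
    from M[THEN spec, THEN mp, OF this] obtain g2 c where g2: "pword a (a + m) g2" "length g2 = M"
      and c: "\<forall>u. length u < m \<longrightarrow> set u \<subseteq> {..<a} \<longrightarrow>
       \<psi>1 (wsubst a u (takeWhile (\<lambda>x. x < a + length u) g2)) = c"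
      by (elim exE conjE) (rule that)
    show "\<exists>g. pword a (a + m) g \<and> length g = N \<and>
       (\<exists>c. \<forall>h. length h = m \<longrightarrow> pword a k h \<longrightarrow> \<psi> (wsubst a h g) = c)"
    proof (intro exI[of _ "wsubst a g2 g1"] exI[of _ c] conjI allI impI)
      show "pword a (a + m) (wsubst a g2 g1)" using g1 g2 by (intro pword_wsubst) auto
      show "length (wsubst a g2 g1) = N" using g1 by simp
      fix h assume h: "length h = m" "pword a k h"
      obtain u t where ut: "h = u @ a # t" "set u \<subseteq> {..<a}" "pword (Suc a) k t"
        using pword_split[OF h(2) assms(2)] .
      have "pword a k (wsubst a h g2)" using h g2 by (intro pword_wsubst) auto
      then obtain v s where vs: "wsubst a h g2 = v @ a # s" "set v \<subseteq> {..<a}" "pword (Suc a) k s"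
        using pword_split[OF _ assms(2)] by metis
      \<comment> \<open>The first \<open>length u\<close> parameters of \<open>g2\<close> receive
        constants and the next one receives \<open>a\<close>, so the prefix of the composite ends
        where \<open>a + length u\<close> first occurs in \<open>g2\<close>.\<close>
      have "v = takeWhile (\<lambda>x. x < a) (wsubst a h g2)"
        unfolding vs(1) using vs(2) by (subst takeWhile_append2) auto
      also have "\<dots> = wsubst a h (takeWhile (\<lambda>x. ([0..<a] @ h) ! x < a) g2)"
        by (simp add: wsubst_def takeWhile_map comp_def)
      also have "takeWhile (\<lambda>x. ([0..<a] @ h) ! x < a) g2 = takeWhile (\<lambda>x. x < a + length u) g2"
      proof (rule takeWhile_pword[OF g2(1)])
        show "([0..<a] @ h) ! y < a" if "y < a + length u" for y
        proof (cases "y < a")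
          case False
          then have "u ! (y - a) \<in> set u" using that by (intro nth_mem) auto
          with ut(2) have "u ! (y - a) < a" by blast
          then show ?thesis using False that by (simp add: ut(1) nth_append)
        qed (simp add: nth_append)
        show "\<not> ([0..<a] @ h) ! (a + length u) < a" by (simp add: ut nth_append)
      qed simp
      also have "wsubst a h \<dots> = wsubst a u (takeWhile (\<lambda>x. x < a + length u) g2)"
        unfolding ut(1) by (rule wsubst_extend) (auto dest: set_takeWhileD)
      finally have v: "v = wsubst a u (takeWhile (\<lambda>x. x < a + length u) g2)" .
      have l: "length v + Suc (length s) = M"
        using arg_cong[OF vs(1), of length] g2 by simp
      have \<tau>: "length v + Suc (length (\<tau> v)) = M \<and> pword (Suc a) k (\<tau> v)"
        unfolding \<tau>_def by (rule someI[of _ s]) (use l vs in simp)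
      have "\<psi> (wsubst a h (wsubst a g2 g1)) = \<psi> (wsubst a (wsubst a h g2) g1)"
        using pword_bounds(2)[OF g1(1)] g2 by (subst wsubst_wsubst) auto
      also have "\<dots> = \<psi>1 v" unfolding vs(1) \<psi>1_def
        using l \<tau> vs by (intro g1(3)[rule_format]) auto
      also have "\<dots> = c" unfolding v using ut h by (intro c[rule_format]) auto
      finally show "\<psi> (wsubst a h (wsubst a g2 g1)) = c" .
    qed
  qed
qed

theorem graham_rothschild:
  assumes "a \<le> k" "a > 0"
  shows "GR a k"
  using assms
proof (induction rule: inc_induct)
  case base
  then show ?case by (rule hales_jewett)
next
  case (step a)
  show ?case by (rule GR_step) (use step in auto)
qed

text \<open>The category provides equidistant spaces of some size above a given bound, not of a
  prescribed size, so all large \<open>n\<close> are needed. Surplus positions are filled with 0, a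
  constant because \<open>0 < a\<close>.\<close>

corollary graham_rothschild_ge:
  assumes "0 < a" "a \<le> k"
  obtains N where "\<And>n (\<psi> :: nat list \<Rightarrow> nat). n \<ge> N \<Longrightarrow> (\<And>t. \<psi> t < r) \<Longrightarrow>
    \<exists>g c. pword a (a + m) g \<and> length g = n \<and>
      (\<forall>h. length h = m \<longrightarrow> pword a k h \<longrightarrow> \<psi> (wsubst a h g) = c)"
proof -
  obtain N where N: "\<And>\<psi> :: nat list \<Rightarrow> nat. (\<And>t. \<psi> t < r) \<Longrightarrow>
      \<exists>g c. pword a (a + m) g \<and> length g = N \<and>
        (\<forall>h. length h = m \<longrightarrow> pword a k h \<longrightarrow> \<psi> (wsubst a h g) = c)"
    using GRE[OF graham_rothschild[OF assms(2,1)], of r m] by blast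
  show thesis
  proof (rule that)
    fix n and \<psi> :: "nat list \<Rightarrow> nat" assume n: "N \<le> n" and \<psi>: "\<And>t. \<psi> t < r"
    let ?z = "replicate (n - N) 0"
    from N[of "\<lambda>t. \<psi> (t @ ?z)", OF \<psi>] obtain g c where
      g: "pword a (a + m) g" "length g = N" and
      c: "\<forall>h. length h = m \<longrightarrow> pword a k h \<longrightarrow> \<psi> (wsubst a h g @ ?z) = c"
      by (elim exE conjE) (rule that)
    have "pword (a + m) (a + m) ?z" using assms by (auto simp: pword_const)
    then have "pword a (a + m) (g @ ?z)" using g by (auto simp: pword_append)
    moreover have "wsubst a h ?z = ?z" for h
      using assms by (intro wsubst_const) auto
    then have "wsubst a h (g @ ?z) = wsubst a h g @ ?z" for h
      by (simp add: wsubst_append)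
    ultimately show "\<exists>g c. pword a (a + m) g \<and> length g = n \<and>
      (\<forall>h. length h = m \<longrightarrow> pword a k h \<longrightarrow> \<psi> (wsubst a h g) = c)"
      using g c n by (intro exI[of _ "g @ ?z"] exI[of _ c]) auto
  qed
qed

section \<open>Rigid surjections as parameter words\<close>

text \<open>Replaces the recursion by a condition on positions, the form in which first occurrences
  can be compared with minima of fibers.\<close>

lemma pword_iff:
  "pword a k t \<longleftrightarrow> {..<a} \<union> set t = {..<k} \<and>
    (\<forall>i<length t. \<forall>v<t ! i. v < a \<or> v \<in> set (take i t))"
proof (induction t arbitrary: a)
  case (Cons x t)
  have all_Suc: "(\<forall>i<length (x # t). P i) \<longleftrightarrow> P 0 \<and> (\<forall>i<length t. P (Suc i))" for P
    by (auto simp: less_Suc_eq_0_disj)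
  consider "x < a" | "x = a" | "x > a" by linarith
  then show ?case
  proof cases
    case 1
    then have "{..<a} \<union> set (x # t) = {..<a} \<union> set t" by auto
    with 1 show ?thesis unfolding all_Suc by (auto simp: Cons.IH)
  next
    case 2
    then have "{..<a} \<union> set (x # t) = {..<Suc a} \<union> set t" by auto
    with 2 show ?thesis unfolding all_Suc by (auto simp: Cons.IH less_Suc_eq)
  next
    case 3
    then show ?thesis unfolding all_Suc by auto
  qed
qed auto

lemma ex_sorted_list:
  assumes "finite X" "strict_linear_order_on X r"
  shows "\<exists>xs. set xs = X \<and> sorted_wrt (\<lambda>x y. (x, y) \<in> r) xs"
  using assms
proof (induction X rule: finite_psubset_induct)
  case (psubset X)
  show ?case
  proof (cases "X = {}")
    case False
    obtain m where m: "m \<in> X" "\<And>x. x \<in> X \<Longrightarrow> x \<noteq> m \<Longrightarrow> (m, x) \<in> r"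
      using ex_chain_min[OF psubset.prems order_refl psubset.hyps(1) False] by blast
    have "strict_linear_order_on (X - {m}) r"
      using psubset.prems by (auto simp: strict_linear_order_on_def total_on_def)
    with psubset.IH[of "X - {m}"] m(1) obtain xs where
      "set xs = X - {m}" "sorted_wrt (\<lambda>x y. (x, y) \<in> r) xs" by blast
    then show ?thesis using m by (intro exI[of _ "m # xs"]) auto
  qed auto
qed

lemma sorted_list_nth_iff:
  assumes "strict_linear_order_on X r" "sorted_wrt (\<lambda>x y. (x, y) \<in> r) xs"
    "i < length xs" "j < length xs"
  shows "(xs ! i, xs ! j) \<in> r \<longleftrightarrow> i < j"
proof -
  have r: "(x, y) \<in> r \<Longrightarrow> (y, x) \<notin> r" "(x, x) \<notin> r" for x y
    using assms(1) unfolding strict_linear_order_on_def trans_def irrefl_def by blast+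
  have "i < j \<Longrightarrow> (xs ! i, xs ! j) \<in> r" "j < i \<Longrightarrow> (xs ! j, xs ! i) \<in> r"
    using assms by (auto simp: sorted_wrt_iff_nth_less)
  with r show ?thesis by (metis nat_neq_iff)
qed

lemma sorted_list_distinct:
  assumes "strict_linear_order_on X r" "sorted_wrt (\<lambda>x y. (x, y) \<in> r) xs"
  shows "distinct xs"
proof -
  have "xs ! i \<noteq> xs ! j" if "i < length xs" "j < length xs" "i < j" for i j
    using sorted_list_nth_iff[OF assms that(1,2)] sorted_list_nth_iff[OF assms that(2,2)] that(3)
    by auto
  then show ?thesis unfolding distinct_conv_nth by (metis nat_neq_iff)
qed

text \<open>The minimum of the fiber over \<open>ys ! v\<close> is \<open>xs ! p v\<close>, where
  \<open>p v\<close> is the first occurrence of \<open>v\<close> in \<open>h\<close>. Rigidity says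
  that \<open>p\<close> is increasing, that is, every letter is preceded by all smaller
  ones.\<close>

lemma rigid_surjection_iff_pword:
  assumes r: "strict_linear_order_on (set xs) r" "sorted_wrt (\<lambda>x y. (x, y) \<in> r) xs"
    and s: "strict_linear_order_on (set ys) s" "sorted_wrt (\<lambda>x y. (x, y) \<in> s) ys"
    and h: "length h = length xs" "set h \<subseteq> {..<length ys}"
    and f: "\<And>i. i < length xs \<Longrightarrow> f (xs ! i) = ys ! (h ! i)"
  shows "rigid_surjection (set xs) r (set ys) s f \<longleftrightarrow> pword 0 (length ys) h"
proof -
  note rn = sorted_list_nth_iff[OF r] and sn = sorted_list_nth_iff[OF s]
  have ysd: "distinct ys" by (rule sorted_list_distinct[OF s])
  have hl: "h ! i < length ys" if "i < length xs" for i using h that by (metis lessThan_iff nth_mem subsetD)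
  have im: "f ` set xs = (!) ys ` set h"
    using f h(1) by (force simp: set_conv_nth image_iff)
  have surj: "f ` set xs = set ys \<longleftrightarrow> set h = {..<length ys}"
  proof -
    have "(!) ys ` {..<length ys} = set ys" by (auto simp: set_conv_nth)
    moreover have "inj_on ((!) ys) {..<length ys}" using ysd by (simp add: inj_on_nth)
    ultimately show ?thesis unfolding im using h(2) by (metis inj_on_image_eq_iff order_refl)
  qed
  define p where "p v = (LEAST i. i < length h \<and> h ! i = v)" for v
  have p: "p v < length h \<and> h ! p v = v" if "v \<in> set h" for v
    using that unfolding p_def in_set_conv_nth by (elim exE) (rule LeastI)
  have p_le: "p (h ! i) \<le> i" if "i < length h" for i
    unfolding p_def using that by (intro Least_le) auto
  have min: "chain_min r (f -` {ys ! v} \<inter> set xs) = xs ! p v" if v: "v \<in> set h" for v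
  proof (rule chain_min_eqI[OF r(1)])
    show "xs ! p v \<in> f -` {ys ! v} \<inter> set xs" using p[OF v] h f by auto
    fix x assume x: "x \<in> f -` {ys ! v} \<inter> set xs" "x \<noteq> xs ! p v"
    then obtain i where i: "i < length xs" "x = xs ! i" by (auto simp: in_set_conv_nth)
    then have "ys ! (h ! i) = ys ! v" using x f by auto
    then have "h ! i = v" using ysd hl[OF i(1)] v h(2) by (metis lessThan_iff nth_eq_iff_index_eq subsetD)
    then have "p v \<le> i" "i \<noteq> p v" using p_le[of i] i x h by auto
    then show "(xs ! p v, x) \<in> r" using rn[of "p v" i] i p[OF v] h by auto
  qed
  show ?thesis
  proof (cases "set h = {..<length ys}")
    case False
    then show ?thesis using surj by (simp add: rigid_surjection_def pword_iff)
  next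
    case True
    have "rigid_surjection (set xs) r (set ys) s f \<longleftrightarrow>
        (\<forall>u<length ys. \<forall>v<length ys. u < v \<longrightarrow> p u < p v)"
    proof -
      have "(\<forall>x\<in>set ys. \<forall>y\<in>set ys. Q x y) \<longleftrightarrow>
          (\<forall>u<length ys. \<forall>v<length ys. Q (ys ! u) (ys ! v))" for Q
        by (metis in_set_conv_nth)
      moreover have "(xs ! p u, xs ! p v) \<in> r \<longleftrightarrow> p u < p v"
        if "u < length ys" "v < length ys" for u v
        using rn p that True h(1) by auto
      ultimately show ?thesis using surj True sn min by (auto simp: rigid_surjection_def)
    qed
    also have "\<dots> \<longleftrightarrow> (\<forall>i<length h. \<forall>v<h ! i. v \<in> set (take i h))"
    proof (intro iffI allI impI)
      fix i v assume *: "\<forall>u<length ys. \<forall>v<length ys. u < v \<longrightarrow> p u < p v" and i: "i < length h" "v < h ! i"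
      have hi: "h ! i < length ys" using i h hl by simp
      with i have v: "v < length ys" by simp
      have "p v < p (h ! i)" using * hi v i by blast
      then have "p v < i" using p_le[OF i(1)] by simp
      moreover have "v = h ! p v" using p[of v] True v by auto
      ultimately show "v \<in> set (take i h)" using i by (auto simp: in_set_conv_nth)
    next
      fix u v assume *: "\<forall>i<length h. \<forall>v<h ! i. v \<in> set (take i h)"
        and uv: "u < length ys" "v < length ys" "u < v"
      have pv: "p v < length h" "h ! p v = v" using p[of v] True uv by auto
      then have "u \<in> set (take (p v) h)" using * uv by auto
      then obtain j where "j < p v" "h ! j = u" by (auto simp: in_set_conv_nth)
      with p_le[of j] pv show "p u < p v" by auto
    qed
    also have "\<dots> \<longleftrightarrow> pword 0 (length ys) h" using True by (simp add: pword_iff)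
    finally show ?thesis .
  qed
qed

section \<open>The dual Ramsey property\<close>

lemma compose_ners:
  assumes "finite_lo_metric_space L" "finite_lo_metric_space M" "finite_lo_metric_space N"
    and "f \<in> ners L M" "g \<in> ners M N"
  shows "compose (points L) g f \<in> ners L N"
proof -
  have "L \<in> Ob OMet_ners" "M \<in> Ob OMet_ners" "N \<in> Ob OMet_ners"
    "f \<in> Hom OMet_ners L M" "g \<in> Hom OMet_ners M N"
    using assms by (simp_all add: OMet_ners_def)
  then have "Comp OMet_ners L M N g f \<in> Hom OMet_ners L N"
    by (rule conjunct1[OF is_category_OMet_ners[unfolded is_category_def], rule_format])
  then show ?thesis by (simp add: OMet_ners_def)
qed

lemma id_ners:
  assumes "finite_lo_metric_space M"
  shows "restrict id (points M) \<in> ners M M"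
proof -
  have "chain_min (ord_rel M) (restrict id (points M) -` {x} \<inter> points M) = x" if "x \<in> points M" for x
    using that assms
    by (intro chain_min_eqI[where A = "points M"]) (auto simp: finite_lo_metric_space_def)
  then show ?thesis by (auto simp: ners_def rigid_surjection_def)
qed

text \<open>\<open>N\<close> depends only on \<open>A\<close>, \<open>B\<close> and
  \<open>k\<close>. The distance condition makes every map from \<open>C\<close> to \<open>B\<close>
  non-expansive; the maps to \<open>A\<close> that matter are composites through \<open>B\<close>
  and inherit this.\<close>

lemma ners_dual_Ramsey:
  fixes A B :: "'a ospace"
  assumes A: "finite_lo_metric_space A" "points A \<noteq> {}"
    and B: "finite_lo_metric_space B" "points B \<noteq> {}"
  obtains N where "\<And>(C :: 'a ospace) \<psi>. finite_lo_metric_space C \<Longrightarrow> card (points C) \<ge> N \<Longrightarrow>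
    (\<And>x y u v. x \<in> points B \<Longrightarrow> y \<in> points B \<Longrightarrow> u \<in> points C \<Longrightarrow> v \<in> points C \<Longrightarrow> u \<noteq> v \<Longrightarrow>
      distance B x y \<le> distance C u v) \<Longrightarrow>
    \<psi> \<in> ners C A \<rightarrow> {1..k::nat} \<Longrightarrow>
    \<exists>w\<in>ners C B. \<psi> constant_on {compose (points C) f w | f. f \<in> ners B A}"
proof -
  have strict: "strict_linear_order_on (points M) (ord_rel M)"
    and fin: "finite (points M)" if "finite_lo_metric_space M" for M :: "'a ospace"
    using that by (auto simp: finite_lo_metric_space_def)
  from ex_sorted_list[OF fin strict, OF A(1) A(1)] obtain as where
    as: "set as = points A" "sorted_wrt (\<lambda>x y. (x, y) \<in> ord_rel A) as" by blast
  from ex_sorted_list[OF fin strict, OF B(1) B(1)] obtain bs where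
    bs: "set bs = points B" "sorted_wrt (\<lambda>x y. (x, y) \<in> ord_rel B) bs" by blast
  have sA: "strict_linear_order_on (set as) (ord_rel A)" and sB: "strict_linear_order_on (set bs) (ord_rel B)"
    using strict[OF A(1)] strict[OF B(1)] as bs by auto
  \<comment> \<open>A rigid surjection sends the first point to the first point, so the leading
    letter 0 is split off: it becomes the only constant, \<open>length bs - 1\<close> parameters
    remain, and \<open>C\<close> needs one point more than the word has letters.\<close>
  define m where "m = length bs - 1"
  have m: "length bs = Suc m" using bs(1) B(2) by (cases bs) (auto simp: m_def)
  have "length as \<ge> 1" using as(1) A(2) by (cases as) auto
  from graham_rothschild_ge[OF zero_less_one this, where r = "Suc k" and m = m]
  obtain N where N: "\<And>n (\<psi> :: nat list \<Rightarrow> nat). n \<ge> N \<Longrightarrow> (\<And>t. \<psi> t < Suc k) \<Longrightarrow>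
    \<exists>g c. pword 1 (1 + m) g \<and> length g = n \<and>
      (\<forall>h. length h = m \<longrightarrow> pword 1 (length as) h \<longrightarrow> \<psi> (wsubst 1 h g) = c)" by blast
  show thesis
  proof (rule that[of "Suc N"])
    fix C :: "'a ospace" and \<psi>
    assume C: "finite_lo_metric_space C" "card (points C) \<ge> Suc N"
      and dist: "\<And>x y u v. x \<in> points B \<Longrightarrow> y \<in> points B \<Longrightarrow> u \<in> points C \<Longrightarrow> v \<in> points C \<Longrightarrow> u \<noteq> v \<Longrightarrow>
        distance B x y \<le> distance C u v"
      and \<psi>: "\<psi> \<in> ners C A \<rightarrow> {1..k}"
    from ex_sorted_list[OF fin strict, OF C(1) C(1)] obtain cs where
      cs: "set cs = points C" "sorted_wrt (\<lambda>x y. (x, y) \<in> ord_rel C) cs" by blast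
    have sC: "strict_linear_order_on (set cs) (ord_rel C)"
      using strict[OF C(1)] cs by auto
    have dc: "distinct cs" by (rule sorted_list_distinct[OF sC cs(2)])
    have lc: "length cs = card (points C)" using distinct_card[OF dc] cs(1) by simp
    define ix where "ix = the_inv_into {..<length cs} ((!) cs)"
    have ix: "ix (cs ! i) = i" if "i < length cs" for i
      unfolding ix_def using that dc by (intro the_inv_into_f_f inj_on_nth) auto
    define F where "F t = (\<lambda>x\<in>points C. as ! ((0 # t) ! ix x))" for t
    \<comment> \<open>\<open>F t\<close> need not be a morphism for an arbitrary list
      \<open>t\<close>, so its color may be anything; capping at \<open>k\<close> gives a bounded
      coloring and changes nothing on actual morphisms.\<close>
    have lt: "min k (\<psi> (F t)) < Suc k" for t by simp
    have le: "N \<le> length cs - 1" using C(2) lc by simp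
    from N[of "length cs - 1" "\<lambda>t. min k (\<psi> (F t))", OF le lt] obtain g c where g: "pword 1 (1 + m) g" "length g = length cs - 1"
      and c: "\<forall>h. length h = m \<longrightarrow> pword 1 (length as) h \<longrightarrow> min k (\<psi> (F (wsubst 1 h g))) = c"
      by (elim exE conjE) (rule that)
    have lg: "length (0 # g) = length cs" using g(2) C(2) lc by simp
    have pg: "pword 0 (length bs) (0 # g)" using g(1) m by simp
    define w where "w = (\<lambda>x\<in>points C. bs ! ((0 # g) ! ix x))"
    have w_nth: "w (cs ! i) = bs ! ((0 # g) ! i)" if "i < length cs" for i
      using that cs(1) ix by (auto simp: w_def)
    have g_nth: "(0 # g) ! i < length bs" if "i < length cs" for i
      using pword_bounds(2)[OF pg] that lg by (metis lessThan_iff nth_mem subsetD)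
    have w_pts: "w x \<in> points B" if "x \<in> points C" for x
      using that w_nth g_nth unfolding cs(1)[symmetric] bs(1)[symmetric] in_set_conv_nth by metis
    have w: "w \<in> ners C B"
    proof -
      have "rigid_surjection (set cs) (ord_rel C) (set bs) (ord_rel B) w"
        using rigid_surjection_iff_pword[OF sC cs(2) sB bs(2) lg _ w_nth] pg pword_bounds(2)[OF pg]
        by blast
      moreover have "distance B (w x) (w y) \<le> distance C x y" if "x \<in> points C" "y \<in> points C" for x y
      proof (cases "x = y")
        case True
        moreover have "Metric_space (points B) (distance B)" "Metric_space (points C) (distance C)"
          using B C by (auto simp: finite_lo_metric_space_def)
        ultimately show ?thesis
          using w_pts that by (simp add: Metric_space.mdist_zero)
      qed (use dist w_pts that in auto)
      ultimately show ?thesis using w_pts cs bs by (auto simp: ners_def w_def)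
    qed
    have "\<psi> (compose (points C) f w) = c" if f: "f \<in> ners B A" for f
    proof -
      have f_pts: "f (bs ! i) \<in> set as" if "i < length bs" for i
        using f that bs as by (auto simp: ners_def)
      then obtain \<eta> where \<eta>: "\<And>i. i < length bs \<Longrightarrow> \<eta> i < length as \<and> f (bs ! i) = as ! \<eta> i"
        unfolding in_set_conv_nth by metis
      define hf where "hf = map \<eta> [0..<length bs]"
      have hf: "length hf = length bs" "set hf \<subseteq> {..<length as}"
        "\<And>i. i < length bs \<Longrightarrow> f (bs ! i) = as ! (hf ! i)"
        using \<eta> by (auto simp: hf_def)
      have "rigid_surjection (set bs) (ord_rel B) (set as) (ord_rel A) f"
        using f as bs by (simp add: ners_def)
      then have phf: "pword 0 (length as) hf"
        using rigid_surjection_iff_pword[OF sB bs(2) sA as(2) hf] by blast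
      then obtain h where h: "hf = 0 # h" "pword 1 (length as) h"
        using m hf(1) by (cases hf) auto
      \<comment> \<open>With the leading 0 restored, \<open>[0..<1] @ h\<close> is the word of
        \<open>f\<close>, so substitution of words is composition of maps.\<close>
      have "compose (points C) f w = F (wsubst 1 h g)"
      proof
        fix x
        show "compose (points C) f w x = F (wsubst 1 h g) x"
        proof (cases "x \<in> points C")
          case True
          then obtain i where i: "i < length cs" "x = cs ! i"
            unfolding cs(1)[symmetric] in_set_conv_nth by blast
          have "0 # wsubst 1 h g = map ((!) hf) (0 # g)" by (simp add: wsubst_def h)
          then have "(0 # wsubst 1 h g) ! i = hf ! ((0 # g) ! i)"
            using i lg by (metis nth_map)
          then show ?thesis using True i ix w_nth g_nth hf(3)
            by (simp add: F_def compose_def)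
        qed (simp add: F_def compose_def)
      qed
      moreover have "length h = m" using h hf m by simp
      ultimately have "min k (\<psi> (compose (points C) f w)) = c" using c h by simp
      moreover have "compose (points C) f w \<in> ners C A"
        by (rule compose_ners[OF C(1) B(1) A(1) w f])
      then have "\<psi> (compose (points C) f w) \<le> k" using \<psi> by auto
      ultimately show ?thesis by simp
    qed
    then have "\<psi> constant_on {compose (points C) f w | f. f \<in> ners B A}"
      by (auto simp: constant_on_def)
    with w show "\<exists>w\<in>ners C B. \<psi> constant_on {compose (points C) f w | f. f \<in> ners B A}" by (intro bexI)
  qed
qed

text \<open>An empty spectrum means at most one point, and surjectivity then leaves no choice. The
  set to be made monochromatic has at most one element, so the identity of \<open>B\<close> can
  serve as \<open>w\<close>.\<close>

lemma ners_unique: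
  assumes "Spec B = {}" "f \<in> ners B A" "g \<in> ners B A"
  shows "f = g"
proof -
  have B: "x = y" if "x \<in> points B" "y \<in> points B" for x y
    using assms(1) that by (auto simp: Spec_def)
  have im: "f ` points B = points A" "g ` points B = points A"
    and ext: "f \<in> extensional (points B)" "g \<in> extensional (points B)"
    using assms(2,3) by (auto simp: ners_def rigid_surjection_def PiE_iff)
  show ?thesis
  proof (rule extensionalityI[OF ext])
    fix x assume x: "x \<in> points B"
    then have "f x \<in> g ` points B" using im by auto
    then show "f x = g x" using B x by auto
  qed
qed

lemma full_subcategory_dual_Ramsey:
  fixes C :: "('a ospace, 'a \<Rightarrow> 'a) cat"
  assumes \<iota>: "inj \<iota>" and full: "full_subcategory C OMet_ners"
    and eq: "\<And>m \<delta>. \<delta> \<in> cat_Spec C \<Longrightarrow> m \<ge> 1 \<Longrightarrow> \<exists>n\<ge>m. equidistant \<iota> n \<delta> \<in> Ob C"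
  shows "dual_Ramsey_property C"
  unfolding dual_Ramsey_property_def
proof (intro allI impI ballI)
  fix k :: nat and A B assume "k \<ge> 2" and AB: "A \<in> Ob C" "B \<in> Ob C" and "Hom C B A \<noteq> {}"
  have fl: "finite_lo_metric_space M" if "M \<in> Ob C" for M
    using full that by (auto simp: full_subcategory_def OMet_ners_def)
  have Hom: "Hom C M N = ners M N" if "M \<in> Ob C" "N \<in> Ob C" for M N
    using full that by (auto simp: full_subcategory_def OMet_ners_def)
  have Comp: "Comp C L M N g f = compose (points L) g f"
    if "L \<in> Ob C" "M \<in> Ob C" "N \<in> Ob C" "f \<in> ners L M" "g \<in> ners M N" for L M N f g
    using full that Hom[OF that(1,2)] Hom[OF that(2,3)] by (auto simp: full_subcategory_def OMet_ners_def)
  have "\<exists>D\<in>Ob C. \<forall>c \<in> ners D A \<rightarrow> {1..k}.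
    \<exists>w\<in>ners D B. c constant_on {compose (points D) f w | f. f \<in> ners B A}"
  proof (cases "Spec B = {}")
    case True
    have "c constant_on {compose (points B) f w | f. f \<in> ners B A}" for c :: "('a \<Rightarrow> 'a) \<Rightarrow> nat" and w
      using ners_unique[OF True, of _ A] unfolding constant_on_def by blast
    with AB id_ners[OF fl[OF AB(2)]] show ?thesis by blast
  next
    case False
    \<comment> \<open>A morphism from the nonempty \<open>B\<close> shows that \<open>A\<close> is
      nonempty, as the existence of a first letter requires.\<close>
    obtain f where f: "f \<in> ners B A" using \<open>Hom C B A \<noteq> {}\<close> Hom AB by auto
    have "Spec B \<subseteq> (\<lambda>(x, y). distance B x y) ` (points B \<times> points B)"
      by (auto simp: Spec_def)
    moreover have "finite (points B)" using fl[OF AB(2)] by (simp add: finite_lo_metric_space_def)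
    ultimately have finS: "finite (Spec B)" by (meson finite_SigmaI finite_imageI finite_subset)
    define \<delta> where "\<delta> = Max (Spec B)"
    have \<delta>: "\<delta> \<in> Spec B" using finS False by (simp add: \<delta>_def)
    then have \<delta>C: "\<delta> \<in> cat_Spec C" using AB by (auto simp: cat_Spec_def)
    have MS: "Metric_space (points B) (distance B)"
      using fl[OF AB(2)] by (simp add: finite_lo_metric_space_def)
    have ge0: "\<delta> \<ge> 0" using \<delta> Metric_space.nonneg[OF MS] by (auto simp: Spec_def)
    have le: "distance B x y \<le> \<delta>" if "x \<in> points B" "y \<in> points B" for x y
    proof (cases "x = y")
      case True
      then show ?thesis using ge0 that Metric_space.mdist_zero[OF MS] by simp
    next
      case False
      then show ?thesis unfolding \<delta>_def using that finS by (intro Max_ge) (auto simp: Spec_def)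
    qed
    have ne: "points B \<noteq> {}" using False by (auto simp: Spec_def)
    then have "points A \<noteq> {}" using f by (auto simp: ners_def rigid_surjection_def)
    show ?thesis
    proof (rule ners_dual_Ramsey[OF fl[OF AB(1)] \<open>points A \<noteq> {}\<close> fl[OF AB(2)] ne, where k = k])
      fix N
      assume N: "\<And>(D :: 'a ospace) \<psi>. finite_lo_metric_space D \<Longrightarrow> card (points D) \<ge> N \<Longrightarrow>
        (\<And>x y u v. x \<in> points B \<Longrightarrow> y \<in> points B \<Longrightarrow> u \<in> points D \<Longrightarrow> v \<in> points D \<Longrightarrow> u \<noteq> v \<Longrightarrow>
          distance B x y \<le> distance D u v) \<Longrightarrow>
        \<psi> \<in> ners D A \<rightarrow> {1..k} \<Longrightarrow>
        \<exists>w\<in>ners D B. \<psi> constant_on {compose (points D) f w | f. f \<in> ners B A}"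
      obtain n where n: "n \<ge> Suc N" "equidistant \<iota> n \<delta> \<in> Ob C" using eq[OF \<delta>C, of "Suc N"] by auto
      let ?D = "equidistant \<iota> n \<delta>"
      have "card (points ?D) = n"
        using \<iota> by (simp add: equidistant_def card_image inj_on_subset)
      moreover have "distance ?D u v = \<delta>" if "u \<in> points ?D" "v \<in> points ?D" "u \<noteq> v" for u v
        using that by (auto simp: equidistant_def)
      ultimately have "\<forall>c \<in> ners ?D A \<rightarrow> {1..k}.
          \<exists>w\<in>ners ?D B. c constant_on {compose (points ?D) f w | f. f \<in> ners B A}"
        using N[OF fl[OF n(2)]] n(1) le by auto
      with n(2) show ?thesis ..
    qed
  qed
  then obtain D where D: "D \<in> Ob C" "\<forall>c \<in> ners D A \<rightarrow> {1..k}.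
    \<exists>w\<in>ners D B. c constant_on {compose (points D) f w | f. f \<in> ners B A}" by blast
  have "{Comp C D B A f w | f. f \<in> Hom C B A} = {compose (points D) f w | f. f \<in> ners B A}"
    if "w \<in> ners D B" for w
    using Comp[OF D(1) AB(2,1) that] Hom[OF AB(2,1)]
    unfolding Setcompr_eq_image by (intro image_cong) auto
  note Comp_set = this
  show "\<exists>D\<in>Ob C. \<forall>c \<in> Hom C D A \<rightarrow> {1..k}.
      \<exists>w\<in>Hom C D B. c constant_on {Comp C D B A f w | f. f \<in> Hom C B A}"
  proof (intro bexI[OF _ D(1)] ballI)
    fix c assume "c \<in> Hom C D A \<rightarrow> {1..k}"
    then have "c \<in> ners D A \<rightarrow> {1..k}" by (simp add: Hom[OF D(1) AB(1)])
    from bspec[OF D(2) this] obtain w where w: "w \<in> ners D B"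
      "c constant_on {compose (points D) f w | f. f \<in> ners B A}" by (elim bexE)
    show "\<exists>w\<in>Hom C D B. c constant_on {Comp C D B A f w | f. f \<in> Hom C B A}"
    proof (rule bexI)
      show "c constant_on {Comp C D B A f w | f. f \<in> Hom C B A}"
        unfolding Comp_set[OF w(1)] by (rule w(2))
      show "w \<in> Hom C D B" unfolding Hom[OF D(1) AB(2)] by (rule w(1))
    qed
  qed
qed

lemma equidistant_in_OMet_ners_on:
  assumes "inj \<iota>" "\<delta> \<in> cat_Spec (OMet_ners_on S :: ('a ospace, 'a \<Rightarrow> 'a) cat)"
  shows "equidistant \<iota> n \<delta> \<in> Ob (OMet_ners_on S)"
proof -
  from assms(2) obtain M :: "'a ospace" and x y where M: "finite_lo_metric_space M" "Spec M \<subseteq> S"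
    "x \<in> points M" "y \<in> points M" "x \<noteq> y" "\<delta> = distance M x y"
    by (auto simp: cat_Spec_def OMet_ners_on_def OMet_ners_def Spec_def)
  then have "\<delta> > 0" "\<delta> \<in> S"
    using Metric_space.mdist_pos_less[of "points M" "distance M"]
    by (auto simp: finite_lo_metric_space_def Spec_def)
  moreover have "Spec (equidistant \<iota> n \<delta>) \<subseteq> {\<delta>}" by (auto simp: Spec_def equidistant_def)
  ultimately show ?thesis
    using finite_lo_metric_space_equidistant[OF assms(1)] by (auto simp: OMet_ners_on_def OMet_ners_def)
qed

lemma dual_Ramsey_OMet_ners_on:
  fixes \<iota> :: "nat \<Rightarrow> 'a"
  assumes "inj \<iota>"
  shows "dual_Ramsey_property (OMet_ners_on S :: ('a ospace, 'a \<Rightarrow> 'a) cat)"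
proof (rule full_subcategory_dual_Ramsey[OF assms full_subcategory_OMet_ners_on])
  fix m \<delta> assume "\<delta> \<in> cat_Spec (OMet_ners_on S :: ('a ospace, 'a \<Rightarrow> 'a) cat)"
  from equidistant_in_OMet_ners_on[OF assms this, of m]
  show "\<exists>n\<ge>m. equidistant \<iota> n \<delta> \<in> Ob (OMet_ners_on S)" by (intro exI[of _ m] conjI order_refl)
qed

theorem theorem3p4:
  fixes \<iota> :: "nat \<Rightarrow> 'a"
  assumes "inj \<iota>"
  shows
    "(\<forall>C :: ('a ospace, 'a \<Rightarrow> 'a) cat.
        full_subcategory C OMet_ners \<longrightarrow>
        (\<forall>m::nat. \<forall>\<delta>\<in>cat_Spec C. m \<ge> 1 \<longrightarrow> (\<exists>n\<ge>m. equidistant \<iota> n \<delta> \<in> Ob C)) \<longrightarrow>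
        dual_Ramsey_property C) \<and>
     dual_Ramsey_property (OMet_ners :: ('a ospace, 'a \<Rightarrow> 'a) cat) \<and>
     (\<forall>S::real set. dual_Ramsey_property (OMet_ners_on S :: ('a ospace, 'a \<Rightarrow> 'a) cat))"
proof (intro conjI allI impI)
  show "dual_Ramsey_property C"
    if "full_subcategory C OMet_ners"
      "\<forall>m::nat. \<forall>\<delta>\<in>cat_Spec C. m \<ge> 1 \<longrightarrow> (\<exists>n\<ge>m. equidistant \<iota> n \<delta> \<in> Ob C)"
    for C :: "('a ospace, 'a \<Rightarrow> 'a) cat"
    by (rule full_subcategory_dual_Ramsey[OF assms that(1)]) (rule that(2)[rule_format])
  have "OMet_ners_on UNIV = (OMet_ners :: ('a ospace, 'a \<Rightarrow> 'a) cat)"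
    by (simp add: OMet_ners_on_def OMet_ners_def)
  then show "dual_Ramsey_property (OMet_ners :: ('a ospace, 'a \<Rightarrow> 'a) cat)"
    using dual_Ramsey_OMet_ners_on[OF assms, of UNIV] by simp
  show "dual_Ramsey_property (OMet_ners_on S :: ('a ospace, 'a \<Rightarrow> 'a) cat)" for S
    by (rule dual_Ramsey_OMet_ners_on[OF assms])
qed

end
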